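(* Let $(M,d)$ be an infinite metric space. The transportation cost space $\mathrm{TC}(M)$ contains $\ell_1$ isometrically (that is, there is a linear isometric embedding of the real Banach space $\ell_1$ into $\mathrm{TC}(M)$) if and only if there exists a sequence of pairs $\{x_i,y_i\}_{i=1}^\infty$ in $M$, with all the elements $x_1,y_1,x_2,y_2,\dots$ distinct, such that for each $n\in\mathbb{N}$ the set $\{x_iy_i\}_{i=1}^n$ of edges is a minimum weight perfect matching in the subgraph of $M$ spanned by $\{x_i,y_i\}_{i=1}^n$.
   Context: Let $(M,d)$ be a metric space. $\mathrm{TP}(M)$ denotes the real vector space of finitely supported functions $f:M\to\mathbb{R}$ with $\sum_{v\in\operatorname{supp} f} f(v)=0$ (transportation problems). For $u\in M$, $\mathbf{1}_u$ is the indicator function of $\{u\}$. A transportation plan for $f\in\mathrm{TP}(M)$ is a representation $f=\sum_{i=1}^n a_i(\mathbf{1}_{x_i}-\mathbf{1}_{y_i})$ with $a_i\ge 0$, $x_i,y_i\in M$; its cost is $\sum_{i=1}^n a_i d(x_i,y_i)$. The norm $\|f\|_{\mathrm{TC}}$ is the minimal cost over all transportation plans for $f$ (the minimum is attained). The transportation cost space $\mathrm{TC}(M)$ is the completion of the normed space $(\mathrm{TP}(M),\|\cdot\|_{\mathrm{TC}})$. The metric space $M$ is viewed as an infinite weighted complete graph with vertex set $M$, in which the weight of each edge is the distance between its ends. Let $V\subset M$ have cardinality $2n$, $n\in\mathbb{N}$. If the edges $\{u_iv_i\}_{i=1}^n$ with $u_i,v_i\in V$, $u_i\ne v_i$, have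 no common ends, then $\{u_iv_i\}_{i=1}^n$ is called a perfect matching of the subgraph of $M$ spanned by $V$. Its weight is $\sum_{i=1}^n d(u_i,v_i)$. It is a minimum weight perfect matching if its weight is minimal among all perfect matchings of the subgraph spanned by $V$. *)

theory Defs
  imports "HOL-Analysis.Analysis"
begin

section \<open>Completion of a real normed space\<close>

text \<open>Cauchy sequences modulo null sequences.\<close>

definition cauchy_rel :: "(nat \<Rightarrow> 'a::real_normed_vector) \<Rightarrow> (nat \<Rightarrow> 'a) \<Rightarrow> bool" where
  "cauchy_rel X Y \<longleftrightarrow> Cauchy X \<and> Cauchy Y \<and> (\<lambda>n. X n - Y n) \<longlonglongrightarrow> 0"

lemma cauchy_rel_refl: "Cauchy X \<Longrightarrow> cauchy_rel X X"
  by (simp add: cauchy_rel_def)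

lemma Cauchy_const_nv: "Cauchy (\<lambda>_. c :: 'a::real_normed_vector)"
  by (rule LIMSEQ_imp_Cauchy[OF tendsto_const])

lemma part_equivp_cauchy_rel: "part_equivp (cauchy_rel :: (nat \<Rightarrow> 'a::real_normed_vector) \<Rightarrow> _)"
proof (rule part_equivpI)
  show "\<exists>X. cauchy_rel X (X :: nat \<Rightarrow> 'a)"
    by (rule exI[of _ "\<lambda>_. 0"]) (simp add: cauchy_rel_def Cauchy_const_nv)
  show "symp (cauchy_rel :: (nat \<Rightarrow> 'a) \<Rightarrow> _)"
    unfolding symp_def cauchy_rel_def
  proof (intro allI impI conjI; (elim conjE)?)
    fix X Y :: "nat \<Rightarrow> 'a"
    assume "(\<lambda>n. X n - Y n) \<longlonglongrightarrow> 0"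
    from tendsto_minus[OF this] show "(\<lambda>n. Y n - X n) \<longlonglongrightarrow> 0" by simp
  qed auto
  show "transp (cauchy_rel :: (nat \<Rightarrow> 'a) \<Rightarrow> _)"
    unfolding transp_def cauchy_rel_def
  proof (intro allI impI conjI; (elim conjE)?)
    fix X Y Z :: "nat \<Rightarrow> 'a"
    assume "(\<lambda>n. X n - Y n) \<longlonglongrightarrow> 0" "(\<lambda>n. Y n - Z n) \<longlonglongrightarrow> 0"
    from tendsto_add[OF this] show "(\<lambda>n. X n - Z n) \<longlonglongrightarrow> 0" by simp
  qed auto
qed

lemma Cauchy_add_nv:
  fixes X Y :: "nat \<Rightarrow> 'a::real_normed_vector"
  assumes "Cauchy X" "Cauchy Y"
  shows "Cauchy (\<lambda>n. X n + Y n)"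
proof (rule CauchyI)
  fix e :: real assume "0 < e"
  then have "0 < e / 2" by simp
  obtain M1 where M1: "\<forall>m\<ge>M1. \<forall>n\<ge>M1. norm (X m - X n) < e / 2"
    using CauchyD[OF assms(1) \<open>0 < e / 2\<close>] by blast
  obtain M2 where M2: "\<forall>m\<ge>M2. \<forall>n\<ge>M2. norm (Y m - Y n) < e / 2"
    using CauchyD[OF assms(2) \<open>0 < e / 2\<close>] by blast
  show "\<exists>M. \<forall>m\<ge>M. \<forall>n\<ge>M. norm (X m + Y m - (X n + Y n)) < e"
  proof (intro exI allI impI)
    fix m n assume "max M1 M2 \<le> m" "max M1 M2 \<le> n"
    then have "norm (X m - X n) < e / 2" "norm (Y m - Y n) < e / 2"
      using M1 M2 by auto
    moreover have "norm (X m + Y m - (X n + Y n)) \<le> norm (X m - X n) + norm (Y m - Y n)"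
      by (metis add_diff_add norm_triangle_ineq)
    ultimately show "norm (X m + Y m - (X n + Y n)) < e" by linarith
  qed
qed

lemma Cauchy_scaleR_nv:
  fixes X :: "nat \<Rightarrow> 'a::real_normed_vector"
  assumes "Cauchy X"
  shows "Cauchy (\<lambda>n. r *\<^sub>R X n)"
  using bounded_linear.Cauchy[OF bounded_linear_scaleR_right assms] .

lemma Cauchy_minus_nv:
  fixes X :: "nat \<Rightarrow> 'a::real_normed_vector"
  assumes "Cauchy X"
  shows "Cauchy (\<lambda>n. - X n)"
  using Cauchy_scaleR_nv[OF assms, of "-1"] by simp

lemma Cauchy_norm_nv:
  fixes X :: "nat \<Rightarrow> 'a::real_normed_vector"
  assumes "Cauchy X"
  shows "Cauchy (\<lambda>n. norm (X n))"
proof (rule CauchyI)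
  fix e :: real assume "0 < e"
  then obtain M where "\<forall>m\<ge>M. \<forall>n\<ge>M. norm (X m - X n) < e"
    using CauchyD[OF assms] by blast
  then show "\<exists>M. \<forall>m\<ge>M. \<forall>n\<ge>M. norm (norm (X m) - norm (X n)) < e"
    by (metis norm_triangle_ineq3 order_le_less_trans real_norm_def)
qed

quotient_type (overloaded) 'a completion_nv = "nat \<Rightarrow> 'a::real_normed_vector" / partial: cauchy_rel
  morphisms rep_completion abs_completion
  by (rule part_equivp_cauchy_rel)

instantiation completion_nv :: (real_normed_vector) real_normed_vector
begin

lift_definition zero_completion_nv :: "'a completion_nv" is "\<lambda>_. 0"
  by (simp add: cauchy_rel_def Cauchy_const_nv)

lift_definition plus_completion_nv :: "'a completion_nv \<Rightarrow> 'a completion_nv \<Rightarrow> 'a completion_nv"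
  is "\<lambda>X Y n. X n + Y n"
  unfolding cauchy_rel_def
proof (intro conjI; (elim conjE)?)
  fix X X' Y Y' :: "nat \<Rightarrow> 'a"
  assume "(\<lambda>n. X n - X' n) \<longlonglongrightarrow> 0" "(\<lambda>n. Y n - Y' n) \<longlonglongrightarrow> 0"
  from tendsto_add[OF this] show "(\<lambda>n. X n + Y n - (X' n + Y' n)) \<longlonglongrightarrow> 0"
    by (simp add: algebra_simps)
qed (auto intro: Cauchy_add_nv)

lift_definition uminus_completion_nv :: "'a completion_nv \<Rightarrow> 'a completion_nv"
  is "\<lambda>X n. - X n"
  unfolding cauchy_rel_def
proof (intro conjI; (elim conjE)?)
  fix X X' :: "nat \<Rightarrow> 'a"
  assume "(\<lambda>n. X n - X' n) \<longlonglongrightarrow> 0"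
  from tendsto_minus[OF this] show "(\<lambda>n. - X n - - X' n) \<longlonglongrightarrow> 0"
    by (simp add: algebra_simps)
qed (auto intro: Cauchy_minus_nv)

lift_definition scaleR_completion_nv :: "real \<Rightarrow> 'a completion_nv \<Rightarrow> 'a completion_nv"
  is "\<lambda>r X n. r *\<^sub>R X n"
  unfolding cauchy_rel_def
proof (intro conjI; (elim conjE)?)
  fix r and X X' :: "nat \<Rightarrow> 'a"
  assume "(\<lambda>n. X n - X' n) \<longlonglongrightarrow> 0"
  from tendsto_scaleR[OF tendsto_const[of r] this] show "(\<lambda>n. r *\<^sub>R X n - r *\<^sub>R X' n) \<longlonglongrightarrow> 0"
    by (simp add: algebra_simps)
qed (auto intro: Cauchy_scaleR_nv)

lift_definition norm_completion_nv :: "'a completion_nv \<Rightarrow> real"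
  is "\<lambda>X. lim (\<lambda>n. norm (X n))"
proof -
  fix X Y :: "nat \<Rightarrow> 'a"
  assume r: "cauchy_rel X Y"
  then have "Cauchy (\<lambda>n. norm (X n))" "Cauchy (\<lambda>n. norm (Y n))"
    by (auto simp: cauchy_rel_def intro: Cauchy_norm_nv)
  then have X: "(\<lambda>n. norm (X n)) \<longlonglongrightarrow> lim (\<lambda>n. norm (X n))"
    and Y: "(\<lambda>n. norm (Y n)) \<longlonglongrightarrow> lim (\<lambda>n. norm (Y n))"
    by (auto simp: Cauchy_convergent_iff convergent_LIMSEQ_iff)
  have "(\<lambda>n. norm (X n) - norm (Y n)) \<longlonglongrightarrow> 0"
  proof (rule Lim_null_comparison)
    show "\<forall>\<^sub>F n in sequentially. norm (norm (X n) - norm (Y n)) \<le> norm (X n - Y n)"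
      by (simp add: norm_triangle_ineq3)
    show "(\<lambda>n. norm (X n - Y n)) \<longlonglongrightarrow> 0"
      using r by (simp add: cauchy_rel_def tendsto_norm_zero)
  qed
  with tendsto_diff[OF X Y] have "lim (\<lambda>n. norm (X n)) - lim (\<lambda>n. norm (Y n)) = 0"
    using LIMSEQ_unique by blast
  then show "lim (\<lambda>n. norm (X n)) = lim (\<lambda>n. norm (Y n))" by simp
qed

definition minus_completion_nv :: "'a completion_nv \<Rightarrow> 'a completion_nv \<Rightarrow> 'a completion_nv" where
  "minus_completion_nv x y = x + (- y)"

definition sgn_completion_nv :: "'a completion_nv \<Rightarrow> 'a completion_nv" where
  "sgn_completion_nv x = scaleR (inverse (norm x)) x"

definition dist_completion_nv :: "'a completion_nv \<Rightarrow> 'a completion_nv \<Rightarrow> real" where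
  "dist_completion_nv x y = norm (x - y)"

definition uniformity_completion_nv :: "('a completion_nv \<times> 'a completion_nv) filter" where
  "uniformity_completion_nv = (INF e\<in>{0<..}. principal {(x, y). dist x y < e})"

definition open_completion_nv :: "'a completion_nv set \<Rightarrow> bool" where
  "open_completion_nv S = (\<forall>x\<in>S. \<forall>\<^sub>F (x', y) in uniformity. x' = x \<longrightarrow> y \<in> S)"

lemma Cauchy_norm_lim:
  fixes X :: "nat \<Rightarrow> 'a"
  assumes "Cauchy X"
  shows "(\<lambda>n. norm (X n)) \<longlonglongrightarrow> lim (\<lambda>n. norm (X n))"
  using Cauchy_norm_nv[OF assms] by (simp add: Cauchy_convergent_iff convergent_LIMSEQ_iff)

instance
proof
  fix x y z :: "'a completion_nv" and r s :: real and S :: "'a completion_nv set"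
  show "x + y + z = x + (y + z)"
    by transfer (auto simp: cauchy_rel_def intro!: Cauchy_add_nv simp: add.assoc)
  show "x + y = y + x"
    by transfer (auto simp: cauchy_rel_def intro!: Cauchy_add_nv simp: add.commute)
  show "0 + x = x"
    by transfer (auto simp: cauchy_rel_def)
  show "- x + x = 0"
    by transfer (auto simp: cauchy_rel_def Cauchy_const_nv)
  show "x - y = x + - y" by (simp add: minus_completion_nv_def)
  show "r *\<^sub>R (x + y) = r *\<^sub>R x + r *\<^sub>R y"
    by transfer (auto simp: cauchy_rel_def scaleR_add_right intro!: Cauchy_add_nv Cauchy_scaleR_nv)
  show "(r + s) *\<^sub>R x = r *\<^sub>R x + s *\<^sub>R x"
    by transfer (auto simp: cauchy_rel_def scaleR_add_left intro!: Cauchy_add_nv Cauchy_scaleR_nv)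
  show "r *\<^sub>R s *\<^sub>R x = (r * s) *\<^sub>R x"
    by transfer (auto simp: cauchy_rel_def intro!: Cauchy_scaleR_nv)
  show "1 *\<^sub>R x = x"
    by transfer (auto simp: cauchy_rel_def)
  show "dist x y = norm (x - y)" by (simp add: dist_completion_nv_def)
  show "sgn x = inverse (norm x) *\<^sub>R x" by (simp add: sgn_completion_nv_def)
  show "uniformity = (INF e\<in>{0<..}. principal {(x :: 'a completion_nv, y). dist x y < e})"
    by (simp add: uniformity_completion_nv_def)
  show "open S = (\<forall>x\<in>S. \<forall>\<^sub>F (x', y) in uniformity. x' = x \<longrightarrow> y \<in> S)"
    by (simp add: open_completion_nv_def)
  show "(norm x = 0) = (x = 0)"
  proof transfer
    fix X :: "nat \<Rightarrow> 'a" assume "cauchy_rel X X"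
    then have X: "Cauchy X" by (simp add: cauchy_rel_def)
    have "(lim (\<lambda>n. norm (X n)) = 0) = (\<lambda>n. norm (X n)) \<longlonglongrightarrow> 0"
      using Cauchy_norm_lim[OF X] LIMSEQ_unique by auto
    also have "\<dots> = cauchy_rel X (\<lambda>_. 0)"
      using X by (simp add: cauchy_rel_def tendsto_norm_zero_iff Cauchy_const_nv)
    finally show "(lim (\<lambda>n. norm (X n)) = 0) = cauchy_rel X (\<lambda>_. 0)" .
  qed
  show "norm (x + y) \<le> norm x + norm y"
  proof transfer
    fix X Y :: "nat \<Rightarrow> 'a" assume "cauchy_rel X X" "cauchy_rel Y Y"
    then have X: "Cauchy X" and Y: "Cauchy Y" by (auto simp: cauchy_rel_def)
    show "lim (\<lambda>n. norm (X n + Y n)) \<le> lim (\<lambda>n. norm (X n)) + lim (\<lambda>n. norm (Y n))"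
      by (rule LIMSEQ_le[OF Cauchy_norm_lim[OF Cauchy_add_nv[OF X Y]]
            tendsto_add[OF Cauchy_norm_lim[OF X] Cauchy_norm_lim[OF Y]]])
        (simp add: norm_triangle_ineq)
  qed
  show "norm (r *\<^sub>R x) = \<bar>r\<bar> * norm x"
  proof transfer
    fix r and X :: "nat \<Rightarrow> 'a" assume "cauchy_rel X X"
    then have X: "Cauchy X" by (auto simp: cauchy_rel_def)
    show "lim (\<lambda>n. norm (r *\<^sub>R X n)) = \<bar>r\<bar> * lim (\<lambda>n. norm (X n))"
      using tendsto_mult[OF tendsto_const[of "\<bar>r\<bar>"] Cauchy_norm_lim[OF X]]
      by (simp add: limI)
  qed
qed

end

lift_definition to_completion :: "'a::real_normed_vector \<Rightarrow> 'a completion_nv" is "\<lambda>x _. x"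
  by (simp add: cauchy_rel_def Cauchy_const_nv)

lemma linear_to_completion: "linear to_completion"
proof (rule linearI)
  show "to_completion (x + y) = to_completion x + to_completion y" for x y :: 'a
    by transfer (simp add: cauchy_rel_def Cauchy_const_nv)
  show "to_completion (r *\<^sub>R x) = r *\<^sub>R to_completion x" for r and x :: 'a
    by transfer (simp add: cauchy_rel_def Cauchy_const_nv)
qed

lemma norm_to_completion: "norm (to_completion x) = norm x"
  by transfer (simp add: limI)

lemma to_completion_tendsto:
  fixes X :: "nat \<Rightarrow> 'a::real_normed_vector"
  assumes X: "Cauchy X"
  shows "(\<lambda>n. to_completion (X n)) \<longlonglongrightarrow> abs_completion X"
proof (rule LIMSEQ_I)
  fix e :: real assume "0 < e"
  then have "0 < e / 2" by simp
  then obtain M where M: "\<forall>m\<ge>M. \<forall>n\<ge>M. norm (X m - X n) < e / 2"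
    using CauchyD[OF X] by blast
  have "norm (to_completion (X m) - abs_completion X) < e" if "M \<le> m" for m
  proof -
    have c: "Cauchy (\<lambda>n. X m + - X n)"
      by (intro Cauchy_add_nv Cauchy_minus_nv X) (simp add: Cauchy_const_nv)
    have "norm (to_completion (X m) - abs_completion X)
        = norm (abs_completion (\<lambda>n. X m + - X n))"
      using X c
      by (simp add: diff_conv_add_uminus to_completion.abs_eq uminus_completion_nv.abs_eq
          plus_completion_nv.abs_eq cauchy_rel_refl Cauchy_minus_nv Cauchy_const_nv
          del: add_uminus_conv_diff)
    also have "\<dots> = lim (\<lambda>n. norm (X m + - X n))"
      using c by (simp add: norm_completion_nv.abs_eq cauchy_rel_refl)
    also have "\<dots> \<le> e / 2"
    proof (rule LIMSEQ_le_const2[OF Cauchy_norm_lim[OF c]])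
      show "\<exists>N. \<forall>n\<ge>N. norm (X m + - X n) \<le> e / 2"
        using M that by (intro exI[of _ M]) (auto intro: less_imp_le)
    qed
    finally show ?thesis using \<open>0 < e\<close> by linarith
  qed
  then show "\<exists>M. \<forall>m\<ge>M. norm (to_completion (X m) - abs_completion X) < e" by blast
qed

lemma closure_range_to_completion:
  "closure (range (to_completion :: 'a::real_normed_vector \<Rightarrow> _)) = UNIV"
proof -
  have "z \<in> closure (range (to_completion :: 'a \<Rightarrow> _))" for z
  proof (induction z rule: completion_nv.abs_induct)
    case (1 X)
    then have "Cauchy X" by (simp add: cauchy_rel_def)
    from to_completion_tendsto[OF this] show ?case
      unfolding closure_sequential
      by (intro exI[of _ "\<lambda>n. to_completion (X n)"] conjI allI rangeI)
  qed
  then show ?thesis by blast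
qed

instance completion_nv :: (real_normed_vector) banach
proof
  fix Z :: "nat \<Rightarrow> 'a completion_nv"
  assume Z: "Cauchy Z"
  have "\<exists>x. dist (to_completion x) (Z n) < inverse (real (Suc n))" for n
  proof -
    have "Z n \<in> closure (range to_completion)" by (simp add: closure_range_to_completion)
    then show ?thesis by (auto simp: closure_approachable simp del: of_nat_Suc)
  qed
  then obtain x where x: "\<And>n. dist (to_completion (x n)) (Z n) < inverse (real (Suc n))"
    by metis
  have d: "(\<lambda>n. to_completion (x n) - Z n) \<longlonglongrightarrow> 0"
  proof (rule Lim_null_comparison[OF _ LIMSEQ_inverse_real_of_nat])
    show "\<forall>\<^sub>F n in sequentially. norm (to_completion (x n) - Z n) \<le> inverse (real (Suc n))"
      using x by (intro always_eventually allI less_imp_le) (simp add: dist_norm)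
  qed
  then have "Cauchy (\<lambda>n. (to_completion (x n) - Z n) + Z n)"
    by (intro Cauchy_add_nv Z LIMSEQ_imp_Cauchy)
  then have C: "Cauchy (\<lambda>n. to_completion (x n))" by simp
  have "norm (to_completion (x m) - to_completion (x n)) = norm (x m - x n)" for m n
    by (metis linear_diff linear_to_completion norm_to_completion)
  with C have "Cauchy x" by (simp add: Cauchy_def dist_norm)
  from tendsto_diff[OF to_completion_tendsto[OF this] d] show "convergent Z"
    by (auto simp: convergent_def)
qed


section \<open>Transportation cost spaces\<close>

typedef 'a TP = "{f :: 'a \<Rightarrow> real. finite {v. f v \<noteq> 0} \<and> (\<Sum>v | f v \<noteq> 0. f v) = 0}"
  morphisms TP_fun Abs_TP
  by (rule exI[of _ "\<lambda>_. 0"]) simp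

setup_lifting type_definition_TP

definition transportation_plan ::
  "('a \<Rightarrow> real) \<Rightarrow> nat \<Rightarrow> (nat \<Rightarrow> real) \<Rightarrow> (nat \<Rightarrow> 'a) \<Rightarrow> (nat \<Rightarrow> 'a) \<Rightarrow> bool" where
  "transportation_plan f n a x y \<longleftrightarrow>
     (\<forall>i<n. 0 \<le> a i) \<and>
     f = (\<lambda>v. \<Sum>i<n. a i * (indicator {x i} v - indicator {y i} v))"

definition plan_cost ::
  "nat \<Rightarrow> (nat \<Rightarrow> real) \<Rightarrow> (nat \<Rightarrow> 'a::metric_space) \<Rightarrow> (nat \<Rightarrow> 'a) \<Rightarrow> real" where
  "plan_cost n a x y = (\<Sum>i<n. a i * dist (x i) (y i))"

text \<open>The infimum is attained for transportation problems, so it is the minimal cost.\<close>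

definition TC_norm :: "('a::metric_space \<Rightarrow> real) \<Rightarrow> real" where
  "TC_norm f = Inf {plan_cost n a x y | n a x y. transportation_plan f n a x y}"

lemma TC_norm_le:
  assumes "transportation_plan f n a x y"
  shows "TC_norm f \<le> plan_cost n a x y"
  unfolding TC_norm_def
proof (rule cInf_lower)
  show "bdd_below {plan_cost n a x y | n a x y. transportation_plan f n a x y}"
    by (rule bdd_belowI[of _ 0]) (auto simp: transportation_plan_def plan_cost_def intro!: sum_nonneg)
qed (use assms in blast)

lemma sum_lessThan_add: "(\<Sum>i<n + m. F i) = (\<Sum>i<n. F i) + (\<Sum>i<m. F (n + i))"
  for F :: "nat \<Rightarrow> real"
  by (induction m) auto

lemma transportation_plan_exists:
  assumes "finite {v. f v \<noteq> 0}" "(\<Sum>v | f v \<noteq> 0. f v) = 0"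
  shows "\<exists>n a x y. transportation_plan f n a x y"
proof -
  let ?S = "{v. f v \<noteq> 0}"
  obtain h n where "?S = h ` {i. i < (n::nat)}" "inj_on h {i. i < n}"
    using finite_imp_nat_seg_image_inj_on[OF assms(1)] by blast
  then have h: "?S = h ` {..<n}" "inj_on h {..<n}"
    by (auto simp: lessThan_def)
  define w :: 'a where "w = undefined"
  let ?x = "\<lambda>i. if f (h i) \<ge> 0 then h i else w"
  let ?y = "\<lambda>i. if f (h i) \<ge> 0 then w else h i"
  have "f v = (\<Sum>i<n. \<bar>f (h i)\<bar> * (indicator {?x i} v - indicator {?y i} v))" for v
  proof -
    have "(\<Sum>i<n. \<bar>f (h i)\<bar> * (indicator {?x i} v - indicator {?y i} v))
        = (\<Sum>i<n. f (h i) * (indicator {h i} v - indicator {w} v))"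
      by (rule sum.cong) (auto simp: algebra_simps)
    also have "\<dots> = (\<Sum>u\<in>?S. f u * (indicator {u} v - indicator {w} v))"
      unfolding h(1) by (simp add: sum.reindex[OF h(2)])
    also have "\<dots> = (\<Sum>u\<in>?S. f u * indicator {u} v) - (\<Sum>u\<in>?S. f u) * indicator {w} v"
      by (simp add: right_diff_distrib sum_subtractf sum_distrib_right)
    also have "\<dots> = (\<Sum>u\<in>?S. if u = v then f u else 0)"
      unfolding assms(2) by (auto simp: indicator_def intro!: sum.cong)
    also have "\<dots> = f v" using assms(1) by (simp add: sum.delta')
    finally show ?thesis by simp
  qed
  note eq = this
  have "transportation_plan f n (\<lambda>i. \<bar>f (h i)\<bar>) ?x ?y"
    unfolding transportation_plan_def by (intro conjI allI impI ext abs_ge_zero) (rule eq)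
  then show ?thesis by blast
qed

lemma transportation_plan_add:
  assumes "transportation_plan f n a x y" "transportation_plan g m b u w"
  shows "\<exists>c p q. transportation_plan (\<lambda>v. f v + g v) (n + m) c p q \<and>
    plan_cost (n + m) c p q = plan_cost n a x y + plan_cost m b u w"
proof (intro exI conjI)
  let ?c = "\<lambda>i. if i < n then a i else b (i - n)"
  let ?p = "\<lambda>i. if i < n then x i else u (i - n)"
  let ?q = "\<lambda>i. if i < n then y i else w (i - n)"
  show "transportation_plan (\<lambda>v. f v + g v) (n + m) ?c ?p ?q"
    using assms unfolding transportation_plan_def by (auto simp: sum_lessThan_add)
  show "plan_cost (n + m) ?c ?p ?q = plan_cost n a x y + plan_cost m b u w"
    unfolding plan_cost_def by (auto simp: sum_lessThan_add)
qed

lemma transportation_plan_scale: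
  assumes "transportation_plan f n a x y"
  shows "\<exists>c p q. transportation_plan (\<lambda>v. r * f v) n c p q \<and>
    plan_cost n c p q = \<bar>r\<bar> * plan_cost n a x y"
proof (intro exI conjI)
  let ?p = "if r \<ge> 0 then x else y"
  let ?q = "if r \<ge> 0 then y else x"
  show "transportation_plan (\<lambda>v. r * f v) n (\<lambda>i. \<bar>r\<bar> * a i) ?p ?q"
  proof -
    have f: "f v = (\<Sum>i<n. a i * (indicator {x i} v - indicator {y i} v))" for v
      using assms unfolding transportation_plan_def by meson
    have "r * f v = (\<Sum>i<n. \<bar>r\<bar> * a i * (indicator {?p i} v - indicator {?q i} v))" for v
      unfolding f sum_distrib_left by (rule sum.cong) (auto simp: algebra_simps)
    then show ?thesis using assms unfolding transportation_plan_def by auto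
  qed
  show "plan_cost n (\<lambda>i. \<bar>r\<bar> * a i) ?p ?q = \<bar>r\<bar> * plan_cost n a x y"
    unfolding plan_cost_def by (auto simp: sum_distrib_left algebra_simps dist_commute)
qed

lemma transportation_plan_duality:
  assumes "transportation_plan f n a x y" "finite {v. f v \<noteq> 0}"
  shows "(\<Sum>v | f v \<noteq> 0. f v * g v) = (\<Sum>i<n. a i * (g (x i) - g (y i)))"
proof -
  let ?S = "{v. f v \<noteq> 0} \<union> x ` {..<n} \<union> y ` {..<n}"
  have fin: "finite ?S" using assms(2) by auto
  have f: "f v = (\<Sum>i<n. a i * (indicator {x i} v - indicator {y i} v))" for v
    using assms(1) unfolding transportation_plan_def by meson
  have ind: "(\<Sum>v\<in>?S. indicator {z} v * g v) = g z" if "z \<in> ?S" for z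
  proof -
    have "(\<Sum>v\<in>?S. indicator {z} v * g v) = (\<Sum>v\<in>?S. if z = v then g v else 0)"
      by (rule sum.cong) (auto simp: indicator_def)
    then show ?thesis using sum.delta'[OF fin, of z g] that by simp
  qed
  have "(\<Sum>v | f v \<noteq> 0. f v * g v) = (\<Sum>v\<in>?S. f v * g v)"
    by (rule sum.mono_neutral_left) (use fin in auto)
  also have "\<dots> = (\<Sum>v\<in>?S. \<Sum>i<n. a i * (indicator {x i} v * g v - indicator {y i} v * g v))"
    by (rule sum.cong[OF refl])
      (subst f, unfold sum_distrib_right, rule sum.cong[OF refl], simp add: algebra_simps)
  also have "\<dots> = (\<Sum>i<n. \<Sum>v\<in>?S. a i * (indicator {x i} v * g v - indicator {y i} v * g v))"
    by (rule sum.swap)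
  also have "\<dots> = (\<Sum>i<n. a i * (g (x i) - g (y i)))"
  proof (rule sum.cong[OF refl])
    fix i assume "i \<in> {..<n}"
    then have "x i \<in> ?S" "y i \<in> ?S" by auto
    then show "(\<Sum>v\<in>?S. a i * (indicator {x i} v * g v - indicator {y i} v * g v))
        = a i * (g (x i) - g (y i))"
      by (simp only: sum_distrib_left[symmetric] sum_subtractf ind)
  qed
  finally show ?thesis .
qed

lemma TC_norm_pos:
  assumes "finite {v. f v \<noteq> 0}" "(\<Sum>v | f v \<noteq> 0. f v) = 0" "f z \<noteq> 0"
  shows "0 < TC_norm f"
proof -
  let ?S = "{v. f v \<noteq> 0}"
  obtain d where d: "0 < d" "\<forall>v\<in>?S. v \<noteq> z \<longrightarrow> d \<le> dist z v"
    using finite_set_avoid[OF assms(1), of z] by blast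
  define g where "g v = sgn (f z) * max 0 (d - dist z v)" for v
  have lip: "g u - g v \<le> dist u v" for u v
  proof -
    have "\<bar>max 0 (d - dist z u) - max 0 (d - dist z v)\<bar> \<le> dist u v"
      using dist_triangle[of z u v] dist_triangle[of z v u] by (auto simp: dist_commute max_def)
    then show ?thesis
      unfolding g_def using assms(3) by (auto simp: sgn_if abs_le_iff)
  qed
  have "(\<Sum>v\<in>?S. f v * g v) = (\<Sum>v\<in>?S. if v = z then \<bar>f z\<bar> * d else 0)"
    using d by (intro sum.cong) (auto simp: g_def abs_sgn max_def not_le)
  also have "\<dots> = \<bar>f z\<bar> * d" using assms by simp
  finally have s: "(\<Sum>v\<in>?S. f v * g v) = \<bar>f z\<bar> * d" .
  have "\<bar>f z\<bar> * d \<le> TC_norm f"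
    unfolding TC_norm_def
  proof (rule cInf_greatest)
    show "{plan_cost n a x y | n a x y. transportation_plan f n a x y} \<noteq> {}"
      using transportation_plan_exists[OF assms(1,2)] by blast
    fix c assume "c \<in> {plan_cost n a x y | n a x y. transportation_plan f n a x y}"
    then obtain n a x y where c: "c = plan_cost n a x y" and p: "transportation_plan f n a x y"
      by blast
    have "(\<Sum>i<n. a i * (g (x i) - g (y i))) \<le> c"
      unfolding c plan_cost_def using p
      by (intro sum_mono mult_left_mono lip) (auto simp: transportation_plan_def)
    then show "\<bar>f z\<bar> * d \<le> c"
      using transportation_plan_duality[OF p assms(1), of g] s by simp
  qed
  moreover have "0 < \<bar>f z\<bar> * d" using d assms(3) by simp
  ultimately show ?thesis by linarith
qed

lemma TC_norm_scale_le:
  assumes "finite {v. f v \<noteq> 0}" "(\<Sum>v | f v \<noteq> 0. f v) = 0" "r \<noteq> 0"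
  shows "TC_norm (\<lambda>v. r * f v) \<le> \<bar>r\<bar> * TC_norm f"
proof -
  have "TC_norm (\<lambda>v. r * f v) / \<bar>r\<bar> \<le> TC_norm f"
    unfolding TC_norm_def[of f]
  proof (rule cInf_greatest)
    show "{plan_cost n a x y | n a x y. transportation_plan f n a x y} \<noteq> {}"
      using transportation_plan_exists[OF assms(1,2)] by blast
    fix c assume "c \<in> {plan_cost n a x y | n a x y. transportation_plan f n a x y}"
    then obtain n a x y where c: "c = plan_cost n a x y" and p: "transportation_plan f n a x y"
      by blast
    obtain b p q where "transportation_plan (\<lambda>v. r * f v) n b p q" "plan_cost n b p q = \<bar>r\<bar> * c"
      using transportation_plan_scale[OF p, of r] c by blast
    then have "TC_norm (\<lambda>v. r * f v) \<le> \<bar>r\<bar> * c"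
      by (metis TC_norm_le)
    then show "TC_norm (\<lambda>v. r * f v) / \<bar>r\<bar> \<le> c"
      using assms(3) by (simp add: pos_divide_le_eq mult.commute)
  qed
  then show ?thesis using assms(3) by (simp add: pos_divide_le_eq mult.commute)
qed

lemma TP_lincomb:
  assumes "finite {v. f v \<noteq> 0} \<and> (\<Sum>v | f v \<noteq> 0. f v) = (0::real)"
    "finite {v. g v \<noteq> 0} \<and> (\<Sum>v | g v \<noteq> 0. g v) = (0::real)"
  shows "finite {v. r * f v + s * g v \<noteq> 0} \<and> (\<Sum>v | r * f v + s * g v \<noteq> 0. r * f v + s * g v) = 0"
proof
  let ?S = "{v. f v \<noteq> 0} \<union> {v. g v \<noteq> 0}"
  have fin: "finite ?S" using assms by auto
  show "finite {v. r * f v + s * g v \<noteq> 0}" by (rule finite_subset[OF _ fin]) auto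
  have "(\<Sum>v | r * f v + s * g v \<noteq> 0. r * f v + s * g v) = (\<Sum>v\<in>?S. r * f v + s * g v)"
    by (rule sum.mono_neutral_left[OF fin]) auto
  also have "\<dots> = r * (\<Sum>v\<in>?S. f v) + s * (\<Sum>v\<in>?S. g v)"
    by (simp add: sum.distrib sum_distrib_left)
  also have "(\<Sum>v\<in>?S. f v) = (\<Sum>v | f v \<noteq> 0. f v)"
    by (rule sum.mono_neutral_right[OF fin]) auto
  also have "(\<Sum>v\<in>?S. g v) = (\<Sum>v | g v \<noteq> 0. g v)"
    by (rule sum.mono_neutral_right[OF fin]) auto
  finally show "(\<Sum>v | r * f v + s * g v \<noteq> 0. r * f v + s * g v) = 0"
    using assms by simp
qed

instantiation TP :: (type) real_vector
begin

lift_definition zero_TP :: "'a TP" is "\<lambda>_. 0" by simp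

lift_definition plus_TP :: "'a TP \<Rightarrow> 'a TP \<Rightarrow> 'a TP" is "\<lambda>f g v. f v + g v"
  subgoal for f g using TP_lincomb[of f g 1 1] by simp
  done

lift_definition uminus_TP :: "'a TP \<Rightarrow> 'a TP" is "\<lambda>f v. - f v"
  subgoal for f using TP_lincomb[of f f "-1" 0] by simp
  done

lift_definition minus_TP :: "'a TP \<Rightarrow> 'a TP \<Rightarrow> 'a TP" is "\<lambda>f g v. f v - g v"
  subgoal for f g using TP_lincomb[of f g 1 "-1"] by simp
  done

lift_definition scaleR_TP :: "real \<Rightarrow> 'a TP \<Rightarrow> 'a TP" is "\<lambda>r f v. r * f v"
  subgoal for r f using TP_lincomb[of f f r 0] by simp
  done

instance
  by standard (transfer; auto simp: algebra_simps)+

end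

instantiation TP :: (metric_space) real_normed_vector
begin

lift_definition norm_TP :: "'a TP \<Rightarrow> real" is TC_norm .

definition sgn_TP :: "'a TP \<Rightarrow> 'a TP" where
  "sgn_TP f = scaleR (inverse (norm f)) f"

definition dist_TP :: "'a TP \<Rightarrow> 'a TP \<Rightarrow> real" where
  "dist_TP f g = norm (f - g)"

definition uniformity_TP :: "('a TP \<times> 'a TP) filter" where
  "uniformity_TP = (INF e\<in>{0<..}. principal {(x, y). dist x y < e})"

definition open_TP :: "'a TP set \<Rightarrow> bool" where
  "open_TP S = (\<forall>x\<in>S. \<forall>\<^sub>F (x', y) in uniformity. x' = x \<longrightarrow> y \<in> S)"

lemma TC_norm_zero: "TC_norm (\<lambda>_::'a. 0) = 0"
proof (rule antisym)
  have "transportation_plan (\<lambda>_::'a. 0) 0 a x y" for a x y by (simp add: transportation_plan_def)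
  from TC_norm_le[OF this] show "TC_norm (\<lambda>_::'a. 0) \<le> 0" by (simp add: plan_cost_def)
  show "0 \<le> TC_norm (\<lambda>_::'a. 0)"
    unfolding TC_norm_def
  proof (rule cInf_greatest)
    show "{plan_cost n a x y | n a x y. transportation_plan (\<lambda>_::'a. 0) n a x y} \<noteq> {}"
      using transportation_plan_exists[of "\<lambda>_::'a. 0"] by auto
  qed (auto simp: transportation_plan_def plan_cost_def intro!: sum_nonneg)
qed

instance
proof
  fix f g :: "'a TP" and r :: real and S :: "'a TP set"
  show "dist f g = norm (f - g)" by (simp add: dist_TP_def)
  show "sgn f = inverse (norm f) *\<^sub>R f" by (simp add: sgn_TP_def)
  show "uniformity = (INF e\<in>{0<..}. principal {(x :: 'a TP, y). dist x y < e})"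
    by (simp add: uniformity_TP_def)
  show "open S = (\<forall>x\<in>S. \<forall>\<^sub>F (x', y) in uniformity. x' = x \<longrightarrow> y \<in> S)"
    by (simp add: open_TP_def)
  show "(norm f = 0) = (f = 0)"
  proof transfer
    fix f :: "'a \<Rightarrow> real" assume f: "finite {v. f v \<noteq> 0} \<and> (\<Sum>v | f v \<noteq> 0. f v) = 0"
    show "(TC_norm f = 0) = (f = (\<lambda>_. 0))"
    proof
      assume "TC_norm f = 0"
      then have "f z = 0" for z using TC_norm_pos[of f z] f by auto
      then show "f = (\<lambda>_. 0)" by blast
    qed (simp add: TC_norm_zero)
  qed
  show "norm (f + g) \<le> norm f + norm g"
  proof transfer
    fix f g :: "'a \<Rightarrow> real"
    assume f: "finite {v. f v \<noteq> 0} \<and> (\<Sum>v | f v \<noteq> 0. f v) = 0"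
      and g: "finite {v. g v \<noteq> 0} \<and> (\<Sum>v | g v \<noteq> 0. g v) = 0"
    let ?C = "\<lambda>f::'a \<Rightarrow> real. {plan_cost n a x y | n a x y. transportation_plan f n a x y}"
    have key: "TC_norm (\<lambda>v. f v + g v) \<le> c + e" if "c \<in> ?C f" "e \<in> ?C g" for c e
    proof -
      from that obtain n a x y m b u w where
        "c = plan_cost n a x y" "e = plan_cost m b u w"
        "transportation_plan f n a x y" "transportation_plan g m b u w" by blast
      moreover from this obtain k p q where
        "transportation_plan (\<lambda>v. f v + g v) (n + m) k p q"
        "plan_cost (n + m) k p q = plan_cost n a x y + plan_cost m b u w"
        using transportation_plan_add[of f n a x y g m b u w] by blast
      ultimately show ?thesis using TC_norm_le[of "\<lambda>v. f v + g v" "n + m" k p q] by simp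
    qed
    have ne: "?C f \<noteq> {}" "?C g \<noteq> {}"
      using transportation_plan_exists f g by blast+
    have "TC_norm (\<lambda>v. f v + g v) - c \<le> TC_norm g" if "c \<in> ?C f" for c
      unfolding TC_norm_def[of g]
    proof (rule cInf_greatest[OF ne(2)])
      fix e assume "e \<in> ?C g"
      from key[OF that this] show "TC_norm (\<lambda>v. f v + g v) - c \<le> e" by linarith
    qed
    then have "TC_norm (\<lambda>v. f v + g v) - TC_norm g \<le> c" if "c \<in> ?C f" for c
      using that by (fastforce simp: algebra_simps)
    then have "TC_norm (\<lambda>v. f v + g v) - TC_norm g \<le> TC_norm f"
      unfolding TC_norm_def[of f] by (intro cInf_greatest[OF ne(1)])
    then show "TC_norm (\<lambda>v. f v + g v) \<le> TC_norm f + TC_norm g" by linarith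
  qed
  show "norm (r *\<^sub>R f) = \<bar>r\<bar> * norm f"
  proof transfer
    fix r :: real and f :: "'a \<Rightarrow> real"
    assume f: "finite {v. f v \<noteq> 0} \<and> (\<Sum>v | f v \<noteq> 0. f v) = 0"
    show "TC_norm (\<lambda>v. r * f v) = \<bar>r\<bar> * TC_norm f"
    proof (cases "r = 0")
      case False
      have le: "TC_norm (\<lambda>v. r * f v) \<le> \<bar>r\<bar> * TC_norm f"
        using TC_norm_scale_le f False by blast
      have rf: "finite {v. r * f v \<noteq> 0} \<and> (\<Sum>v | r * f v \<noteq> 0. r * f v) = 0"
        using TP_lincomb[OF f f, of r 0] by simp
      have "TC_norm (\<lambda>v. inverse r * (r * f v)) \<le> \<bar>inverse r\<bar> * TC_norm (\<lambda>v. r * f v)"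
        by (rule TC_norm_scale_le) (use rf False in auto)
      moreover have "(\<lambda>v. inverse r * (r * f v)) = f" using False by auto
      ultimately have "TC_norm f \<le> TC_norm (\<lambda>v. r * f v) / \<bar>r\<bar>"
        by (simp add: divide_inverse mult.commute)
      then have "\<bar>r\<bar> * TC_norm f \<le> TC_norm (\<lambda>v. r * f v)"
        using False by (simp add: pos_le_divide_eq mult.commute)
      with le show ?thesis by linarith
    qed (simp add: TC_norm_zero)
  qed
qed

end

type_synonym 'a TC = "'a TP completion_nv"


section \<open>The space of absolutely summable real sequences\<close>

typedef ell1 = "{s :: nat \<Rightarrow> real. summable (\<lambda>n. \<bar>s n\<bar>)}"
  morphisms ell1_nth Abs_ell1
  by (rule exI[of _ "\<lambda>_. 0"]) simp

setup_lifting type_definition_ell1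

lemma summable_abs_add:
  fixes s t :: "nat \<Rightarrow> real"
  assumes "summable (\<lambda>n. \<bar>s n\<bar>)" "summable (\<lambda>n. \<bar>t n\<bar>)"
  shows "summable (\<lambda>n. \<bar>s n + t n\<bar>)"
  by (rule summable_comparison_test'[OF summable_add[OF assms]]) auto

lemma summable_abs_cmult:
  fixes s :: "nat \<Rightarrow> real"
  assumes "summable (\<lambda>n. \<bar>s n\<bar>)"
  shows "summable (\<lambda>n. \<bar>r * s n\<bar>)"
  using summable_mult[OF assms, of "\<bar>r\<bar>"] by (simp add: abs_mult)

instantiation ell1 :: real_normed_vector
begin

lift_definition zero_ell1 :: ell1 is "\<lambda>_. 0" by simp

lift_definition plus_ell1 :: "ell1 \<Rightarrow> ell1 \<Rightarrow> ell1" is "\<lambda>s t n. s n + t n"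
  by (rule summable_abs_add)

lift_definition uminus_ell1 :: "ell1 \<Rightarrow> ell1" is "\<lambda>s n. - s n" by simp

lift_definition minus_ell1 :: "ell1 \<Rightarrow> ell1 \<Rightarrow> ell1" is "\<lambda>s t n. s n - t n"
  subgoal for s t using summable_abs_add[of s "\<lambda>n. - t n"] by simp
  done

lift_definition scaleR_ell1 :: "real \<Rightarrow> ell1 \<Rightarrow> ell1" is "\<lambda>r s n. r * s n"
  by (rule summable_abs_cmult)

lift_definition norm_ell1 :: "ell1 \<Rightarrow> real" is "\<lambda>s. \<Sum>n. \<bar>s n\<bar>" .

definition sgn_ell1 :: "ell1 \<Rightarrow> ell1" where
  "sgn_ell1 s = scaleR (inverse (norm s)) s"

definition dist_ell1 :: "ell1 \<Rightarrow> ell1 \<Rightarrow> real" where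
  "dist_ell1 s t = norm (s - t)"

definition uniformity_ell1 :: "(ell1 \<times> ell1) filter" where
  "uniformity_ell1 = (INF e\<in>{0<..}. principal {(x, y). dist x y < e})"

definition open_ell1 :: "ell1 set \<Rightarrow> bool" where
  "open_ell1 S = (\<forall>x\<in>S. \<forall>\<^sub>F (x', y) in uniformity. x' = x \<longrightarrow> y \<in> S)"

instance
proof
  fix x y z :: ell1 and r s :: real and S :: "ell1 set"
  show "x + y + z = x + (y + z)" by transfer (simp add: add.assoc)
  show "x + y = y + x" by transfer (simp add: add.commute)
  show "0 + x = x" by transfer simp
  show "- x + x = 0" by transfer simp
  show "x - y = x + - y" by transfer simp
  show "r *\<^sub>R (x + y) = r *\<^sub>R x + r *\<^sub>R y" by transfer (simp add: distrib_left)
  show "(r + s) *\<^sub>R x = r *\<^sub>R x + s *\<^sub>R x" by transfer (simp add: distrib_right)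
  show "r *\<^sub>R s *\<^sub>R x = (r * s) *\<^sub>R x" by transfer (simp add: mult.assoc)
  show "1 *\<^sub>R x = x" by transfer simp
  show "dist x y = norm (x - y)" by (simp add: dist_ell1_def)
  show "sgn x = inverse (norm x) *\<^sub>R x" by (simp add: sgn_ell1_def)
  show "uniformity = (INF e\<in>{0<..}. principal {(x :: ell1, y). dist x y < e})"
    by (simp add: uniformity_ell1_def)
  show "open S = (\<forall>x\<in>S. \<forall>\<^sub>F (x', y) in uniformity. x' = x \<longrightarrow> y \<in> S)"
    by (simp add: open_ell1_def)
  show "(norm x = 0) = (x = 0)"
    by transfer (auto simp: suminf_eq_zero_iff)
  show "norm (x + y) \<le> norm x + norm y"
  proof transfer
    fix s t :: "nat \<Rightarrow> real"
    assume st: "summable (\<lambda>n. \<bar>s n\<bar>)" "summable (\<lambda>n. \<bar>t n\<bar>)"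
    show "(\<Sum>n. \<bar>s n + t n\<bar>) \<le> (\<Sum>n. \<bar>s n\<bar>) + (\<Sum>n. \<bar>t n\<bar>)"
      unfolding suminf_add[OF st]
      by (intro suminf_le abs_triangle_ineq summable_abs_add summable_add st)
  qed
  show "norm (r *\<^sub>R x) = \<bar>r\<bar> * norm x"
    by transfer (simp add: abs_mult suminf_mult)
qed

end


section \<open>Minimum weight perfect matchings\<close>

text \<open>The edges of a matching are \<open>u i v i\<close> for \<open>i < n\<close>; the values of \<open>u\<close> and \<open>v\<close>
  outside this range are irrelevant.\<close>

definition perfect_matching :: "'a set \<Rightarrow> nat \<Rightarrow> (nat \<Rightarrow> 'a) \<Rightarrow> (nat \<Rightarrow> 'a) \<Rightarrow> bool" where
  "perfect_matching V n u v \<longleftrightarrow>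
     finite V \<and> card V = 2 * n \<and>
     (\<forall>i<n. u i \<in> V \<and> v i \<in> V \<and> u i \<noteq> v i) \<and>
     (\<forall>i<n. \<forall>j<n. i \<noteq> j \<longrightarrow> {u i, v i} \<inter> {u j, v j} = {})"

definition matching_weight :: "nat \<Rightarrow> (nat \<Rightarrow> 'a::metric_space) \<Rightarrow> (nat \<Rightarrow> 'a) \<Rightarrow> real" where
  "matching_weight n u v = (\<Sum>i<n. dist (u i) (v i))"

definition min_weight_perfect_matching ::
  "'a::metric_space set \<Rightarrow> nat \<Rightarrow> (nat \<Rightarrow> 'a) \<Rightarrow> (nat \<Rightarrow> 'a) \<Rightarrow> bool" where
  "min_weight_perfect_matching V n u v \<longleftrightarrow>
     perfect_matching V n u v \<and>
     (\<forall>u' v'. perfect_matching V n u' v' \<longrightarrow> matching_weight n u v \<le> matching_weight n u' v')"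

end

theory Submission
  imports Defs "HOL-Combinatorics.Cycles"
begin

text \<open>
  Everything rests on duality with 1-Lipschitz functions: \<open>norm f\<close> is the largest value of
  \<open>\<Sum>v. f v * g v\<close> over 1-Lipschitz \<open>g\<close>. Call the pairs \<open>x i, y i\<close> optimal if they form a sequence
  as in the theorem.

  From optimal pairs to \<open>ell1\<close>. The molecules \<open>(1_{x i} - 1_{y i}) / d (x i) (y i)\<close> span \<open>ell1\<close>
  isometrically as soon as, for every choice of signs, some 1-Lipschitz \<open>g\<close> satisfies
  \<open>g (x i) - g (y i) = \<plusminus>d (x i) (y i)\<close> on any finite number of pairs. Exchanging the ends of the
  pairs of negative sign, all signs become positive, and minimality of the weight against the
  matchings \<open>x i \<mapsto> y (\<sigma> i)\<close> is cyclical monotonicity; shortest paths then give the potential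
  \<open>g\<close> (\<open>cyclically_monotone_potential\<close>, \<open>norming_function_of_minimal_matching\<close>).

  From \<open>ell1\<close> to optimal pairs. The isometry need not have anything to do with the pairs when the
  space has small distances. An injective Cauchy sequence always contains optimal pairs
  (\<open>optimal_pairs_if_Cauchy\<close>), and so does any space with arbitrarily small positive distances
  (\<open>optimal_pairs_if_not_uniformly_discrete\<close>). In the remaining case distinct points are at
  distance at least \<open>\<delta> > 0\<close>, hence elements of the completion are absolutely summable functions.
  Let \<open>F i\<close> be the images of the unit vectors. The heart of the proof is that each \<open>F i\<close> has a tight
  pair \<open>u i, v i\<close>: every \<open>g\<close> that norms \<open>F i\<close> attains \<open>g (u i) - g (v i) = d (u i) (v i)\<close>
  (\<open>tight_pair\<close>). For a point \<open>u\<close> of positive mass, a norming \<open>g\<close> must be tight between \<open>u\<close> and some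
  point of a fixed finite set \<open>K\<close> that carries all but a small part of the negative mass, since otherwise \<open>g\<close> could be
  increased with profit at \<open>u\<close>; and averaging norming functions shows that one point of \<open>K\<close>
  serves them all.

  For every choice of signs, \<open>\<Sum>i<n. \<plusminus>F i\<close> has norm \<open>n\<close>, so a function norming it has all
  differences along the tight pairs maximal with these signs. Regard the pairs as edges. Either
  infinitely many share an end, in which case the other ends form a metric star and any disjoint
  pairs of them are optimal, or infinitely many are disjoint. To compare disjoint pairs with another perfect
  matching, choose the signs by a proper 2-colouring of the union of both matchings, which consists
  of even cycles: then \<open>\<plusminus>g\<close>, signed by colour, is a potential that is exact on the pairs and
  admissible on the other matching (\<open>optimal_pairs_if_disjoint_tight_family\<close>).

  In the lemmas, norming and tightness are meant up to errors that can be made arbitrarily small;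
  the comparison of weights then follows by letting the errors tend to 0.\<close>

section \<open>Perfect matchings\<close>

definition optimal_pairs :: "(nat \<Rightarrow> 'a::metric_space) \<Rightarrow> (nat \<Rightarrow> 'a) \<Rightarrow> bool" where
  "optimal_pairs x y \<longleftrightarrow> inj x \<and> inj y \<and> range x \<inter> range y = {} \<and>
     (\<forall>n\<ge>1. min_weight_perfect_matching (x ` {..<n} \<union> y ` {..<n}) n x y)"

lemma perfect_matching_ends:
  assumes "perfect_matching V n u v"
  shows "inj_on u {..<n}" "inj_on v {..<n}" "u ` {..<n} \<inter> v ` {..<n} = {}"
    "u ` {..<n} \<union> v ` {..<n} = V"
proof -
  note pm = assms[unfolded perfect_matching_def]
  show iu: "inj_on u {..<n}" and iv: "inj_on v {..<n}"
    using pm by (fastforce simp: inj_on_def)+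
  show d: "u ` {..<n} \<inter> v ` {..<n} = {}"
  proof (rule ccontr)
    assume "u ` {..<n} \<inter> v ` {..<n} \<noteq> {}"
    then obtain i j where ij: "i < n" "j < n" "u i = v j" by blast
    show False
    proof (cases "i = j")
      case True
      then show ?thesis using pm ij by auto
    next
      case False
      then have "{u i, v i} \<inter> {u j, v j} = {}" using pm ij by blast
      then show ?thesis using ij by auto
    qed
  qed
  have "card (u ` {..<n} \<union> v ` {..<n}) = card V"
    using pm by (simp add: card_Un_disjoint d card_image iu iv)
  moreover have "u ` {..<n} \<union> v ` {..<n} \<subseteq> V" using pm by auto
  ultimately show "u ` {..<n} \<union> v ` {..<n} = V"
    using pm by (intro card_subset_eq) auto
qed

lemma perfect_matchingI:
  assumes "inj_on u {..<n}" "inj_on v {..<n}" "u ` {..<n} \<inter> v ` {..<n} = {}"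
  shows "perfect_matching (u ` {..<n} \<union> v ` {..<n}) n u v"
proof -
  have "card (u ` {..<n} \<union> v ` {..<n}) = 2 * n"
    by (simp add: card_Un_disjoint assms card_image)
  moreover have "u i \<noteq> v j" if "i < n" "j < n" for i j
    using assms(3) that by auto
  ultimately show ?thesis
    using assms(1,2) unfolding perfect_matching_def
    by (auto dest: inj_onD)
qed

lemma sum_perfect_matching:
  fixes R :: "'a \<Rightarrow> real"
  assumes "perfect_matching V n u v"
  shows "(\<Sum>i<n. R (u i) + R (v i)) = sum R V"
proof -
  note e = perfect_matching_ends[OF assms]
  have "sum R V = sum R (u ` {..<n}) + sum R (v ` {..<n})"
    unfolding e(4)[symmetric] by (rule sum.union_disjoint) (use e(3) in auto)
  then show ?thesis
    by (simp add: sum.reindex e(1,2) sum.distrib)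
qed

lemma perfect_matching_partner:
  assumes "perfect_matching V n u v"
  obtains \<alpha> where "\<And>p. p \<in> V \<Longrightarrow> \<alpha> p \<in> V \<and> \<alpha> p \<noteq> p \<and> \<alpha> (\<alpha> p) = p"
    "\<And>i. i < n \<Longrightarrow> \<alpha> (u i) = v i"
proof -
  note e = perfect_matching_ends[OF assms]
  define \<alpha> where "\<alpha> p = (if p \<in> u ` {..<n} then v (the_inv_into {..<n} u p)
    else u (the_inv_into {..<n} v p))" for p
  have au: "\<alpha> (u i) = v i" if "i < n" for i
    using that by (simp add: \<alpha>_def the_inv_into_f_f e)
  have av: "\<alpha> (v i) = u i" if "i < n" for i
  proof -
    have "v i \<notin> u ` {..<n}" using e(3) that by blast
    then show ?thesis using that by (simp add: \<alpha>_def the_inv_into_f_f e)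
  qed
  have ne: "u i \<noteq> v i" if "i < n" for i using e(3) that by blast
  show ?thesis
  proof (rule that[of \<alpha>])
    fix p assume "p \<in> V"
    then obtain i where i: "i < n" "p = u i \<or> p = v i" unfolding e(4)[symmetric] by auto
    have "u i \<in> V" "v i \<in> V" using i(1) e(4) by auto
    then show "\<alpha> p \<in> V \<and> \<alpha> p \<noteq> p \<and> \<alpha> (\<alpha> p) = p"
      using i au av ne[OF i(1)] by auto
  qed (rule au)
qed

text \<open>The union of two perfect matchings, given by their partner maps, consists of even cycles. Instead
  of cycles the proof contracts one edge of the first matching: remove an edge \<open>p q\<close> of \<open>\<alpha>\<close>, let \<open>\<beta>\<close> match the two
  abandoned partners with each other, colour the rest, and give \<open>p\<close> and \<open>q\<close> the colours opposite to
  those of their \<open>\<beta>\<close>-partners.\<close>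

lemma two_colouring_of_involutions:
  assumes "finite V"
    and "\<And>p. p \<in> V \<Longrightarrow> \<alpha> p \<in> V \<and> \<alpha> p \<noteq> p \<and> \<alpha> (\<alpha> p) = p"
    and "\<And>p. p \<in> V \<Longrightarrow> \<beta> p \<in> V \<and> \<beta> p \<noteq> p \<and> \<beta> (\<beta> p) = p"
  shows "\<exists>c :: 'a \<Rightarrow> bool. \<forall>p\<in>V. c (\<alpha> p) \<noteq> c p \<and> c (\<beta> p) \<noteq> c p"
  using assms
proof (induction "card V" arbitrary: V \<beta> rule: less_induct)
  case less
  note a = less.prems(2) and b = less.prems(3)
  show ?case
  proof (cases "V = {}")
    case False
    then obtain p where p: "p \<in> V" by blast
    define q where "q = \<alpha> p"
    have q: "q \<in> V" "q \<noteq> p" "\<alpha> q = p" using a[OF p] by (auto simp: q_def)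
    define W where "W = V - {p, q}"
    have aW: "\<alpha> w \<in> W \<and> \<alpha> w \<noteq> w \<and> \<alpha> (\<alpha> w) = w" if "w \<in> W" for w
    proof -
      have w: "w \<in> V" "w \<noteq> p" "w \<noteq> q" using that by (auto simp: W_def)
      then have "\<alpha> w \<noteq> p" "\<alpha> w \<noteq> q" using a[OF w(1)] q by (auto simp: q_def)
      then show ?thesis using a[OF w(1)] by (simp add: W_def)
    qed
    have card: "card W < card V"
      unfolding W_def using less.prems(1) p by (intro psubset_card_mono) auto
    have fin: "finite W" using less.prems(1) by (simp add: W_def)
    define \<gamma> where "\<gamma> w = (if w = \<beta> p then \<beta> q else if w = \<beta> q then \<beta> p else \<beta> w)" for w
    have bpq: "\<beta> p \<noteq> \<beta> q" using b[OF p] b[OF q(1)] q(2) by metis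
    have gW: "\<gamma> w \<in> W \<and> \<gamma> w \<noteq> w \<and> \<gamma> (\<gamma> w) = w" if "w \<in> W" for w
    proof -
      have w: "w \<in> V" "w \<noteq> p" "w \<noteq> q" using that by (auto simp: W_def)
      consider "w = \<beta> p" | "w = \<beta> q" | "w \<noteq> \<beta> p" "w \<noteq> \<beta> q" by blast
      then show ?thesis
      proof cases
        case 1
        then have "\<beta> q \<noteq> p" using b[OF q(1)] w by auto
        then show ?thesis using 1 bpq b[OF q(1)] w by (auto simp: \<gamma>_def W_def)
      next
        case 2
        then have "\<beta> p \<noteq> q" using b[OF p] w by auto
        then show ?thesis using 2 bpq b[OF p] w by (auto simp: \<gamma>_def W_def)
      next
        case 3
        have "\<beta> w \<noteq> p" "\<beta> w \<noteq> q" using b[OF w(1)] 3 by auto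
        moreover have "\<beta> w \<noteq> \<beta> p" "\<beta> w \<noteq> \<beta> q"
          using b[OF w(1)] b[OF p] b[OF q(1)] w by metis+
        ultimately show ?thesis using 3 b[OF w(1)] by (auto simp: \<gamma>_def W_def)
      qed
    qed
    obtain c where c: "\<forall>w\<in>W. c (\<alpha> w) \<noteq> c w \<and> c (\<gamma> w) \<noteq> (c w :: bool)"
      using less.hyps[OF card fin aW gW] by blast
    \<comment> \<open>If \<open>p\<close> and \<open>q\<close> are also \<open>\<beta>\<close>-partners, nothing constrains them from outside.\<close>
    define c' where "c' w = (if w = p then (if \<beta> p = q then True else \<not> c (\<beta> p))
      else if w = q then (if \<beta> p = q then False else \<not> c (\<beta> q)) else c w)" for w
    have cpq: "c' p \<noteq> c' q"
    proof (cases "\<beta> p = q")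
      case False
      then have "\<beta> p \<in> W" using b[OF p] by (auto simp: W_def)
      moreover have "\<gamma> (\<beta> p) = \<beta> q" by (simp add: \<gamma>_def)
      ultimately have "c (\<beta> q) \<noteq> c (\<beta> p)" using c by metis
      then show ?thesis using False q(2) by (simp add: c'_def)
    qed (use q(2) in \<open>simp add: c'_def\<close>)
    have "c' (\<alpha> w) \<noteq> c' w \<and> c' (\<beta> w) \<noteq> c' w" if w: "w \<in> V" for w
    proof
      show "c' (\<alpha> w) \<noteq> c' w"
      proof (cases "w \<in> W")
        case True
        then show ?thesis using aW[OF True] c by (auto simp: c'_def W_def)
      next
        case False
        then have "w = p \<or> w = q" using w by (simp add: W_def)
        then show ?thesis using cpq q by (auto simp: q_def)
      qed
      show "c' (\<beta> w) \<noteq> c' w"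
      proof (cases "\<beta> p = q")
        case True
        then have qp: "\<beta> q = p" using b[OF p] by auto
        show ?thesis
        proof (cases "w \<in> W")
          case W: True
          then have "\<gamma> w = \<beta> w" using True qp by (auto simp: \<gamma>_def W_def)
          then have "\<beta> w \<in> W" "c (\<beta> w) \<noteq> c w" using gW[OF W] c W by metis+
          then show ?thesis using W by (auto simp: c'_def W_def)
        next
          case False
          then have "w = p \<or> w = q" using w by (simp add: W_def)
          then show ?thesis using cpq True qp by metis
        qed
      next
        case False
        then have qp: "\<beta> q \<noteq> p" using b[OF q(1)] by auto
        have bb: "\<beta> p \<noteq> p" "\<beta> q \<noteq> q" "\<beta> (\<beta> p) = p" "\<beta> (\<beta> q) = q"
          using b[OF p] b[OF q(1)] by auto
        consider "w = p" | "w = q" | "w = \<beta> p" | "w = \<beta> q" | "w \<in> W" "w \<noteq> \<beta> p" "w \<noteq> \<beta> q"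
          using w by (auto simp: W_def)
        then show ?thesis
        proof cases
          case 5
          then have g: "\<gamma> w = \<beta> w" by (simp add: \<gamma>_def)
          then have "\<beta> w \<in> W" "c (\<beta> w) \<noteq> c w" using gW[OF 5(1)] c 5(1) by metis+
          then show ?thesis using 5(1) by (auto simp: c'_def W_def)
        qed (use False qp bb q(2) in \<open>simp_all add: c'_def\<close>)
      qed
    qed
    then show ?thesis by blast
  qed simp
qed

lemma two_colouring_of_matchings:
  assumes "perfect_matching V n u v" "perfect_matching V n x y"
  obtains c :: "'a \<Rightarrow> bool" where "\<And>i. i < n \<Longrightarrow> c (u i) \<noteq> c (v i)" "\<And>i. i < n \<Longrightarrow> c (x i) \<noteq> c (y i)"
proof -
  obtain \<alpha> where \<alpha>: "\<And>p. p \<in> V \<Longrightarrow> \<alpha> p \<in> V \<and> \<alpha> p \<noteq> p \<and> \<alpha> (\<alpha> p) = p"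
    "\<And>i. i < n \<Longrightarrow> \<alpha> (u i) = v i" using perfect_matching_partner[OF assms(1)] by blast
  obtain \<beta> where \<beta>: "\<And>p. p \<in> V \<Longrightarrow> \<beta> p \<in> V \<and> \<beta> p \<noteq> p \<and> \<beta> (\<beta> p) = p"
    "\<And>i. i < n \<Longrightarrow> \<beta> (x i) = y i" using perfect_matching_partner[OF assms(2)] by blast
  have "finite V" using assms(1) by (simp add: perfect_matching_def)
  from two_colouring_of_involutions[OF this \<alpha>(1) \<beta>(1)]
  obtain c :: "'a \<Rightarrow> bool" where c: "\<forall>p\<in>V. c (\<alpha> p) \<noteq> c p \<and> c (\<beta> p) \<noteq> c p" by auto
  show ?thesis
  proof (rule that[of c])
    fix i assume i: "i < n"
    have "u i \<in> V" "x i \<in> V" using assms i by (auto simp: perfect_matching_def)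
    then show "c (u i) \<noteq> c (v i)" "c (x i) \<noteq> c (y i)" using c \<alpha>(2)[OF i] \<beta>(2)[OF i] by metis+
  qed
qed

text \<open>Every perfect matching of \<open>V\<close> gives the same sum of \<open>R\<close> over the ends of its edges, namely the sum of
  \<open>R\<close> over \<open>V\<close>; a potential is thus a dual certificate of minimal weight, up to the error \<open>e\<close> per
  edge.\<close>

lemma matching_weight_le_if_potential:
  assumes "perfect_matching V n x y" "perfect_matching V n u v"
    and "\<And>i. i < n \<Longrightarrow> dist (x i) (y i) \<le> R (x i) + R (y i) + e"
    and "\<And>i. i < n \<Longrightarrow> R (u i) + R (v i) \<le> dist (u i) (v i)"
  shows "matching_weight n x y \<le> matching_weight n u v + n * e"
proof -
  have "matching_weight n x y \<le> (\<Sum>i<n. R (x i) + R (y i) + e)"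
    unfolding matching_weight_def by (intro sum_mono assms(3)) simp
  also have "\<dots> = (\<Sum>i<n. R (u i) + R (v i)) + n * e"
    using sum_perfect_matching[OF assms(1), of R] sum_perfect_matching[OF assms(2), of R]
    by (simp add: sum.distrib)
  also have "(\<Sum>i<n. R (u i) + R (v i)) \<le> matching_weight n u v"
    unfolding matching_weight_def by (intro sum_mono assms(4)) simp
  finally show ?thesis by simp
qed

lemma optimal_pairs_if_potential:
  assumes "inj x" "inj y" "range x \<inter> range y = {}"
    and "\<And>i. dist (x i) (y i) \<le> R (x i) + R (y i)"
    and "\<And>p q. p \<in> range x \<union> range y \<Longrightarrow> q \<in> range x \<union> range y \<Longrightarrow> p \<noteq> q \<Longrightarrow> R p + R q \<le> dist p q"
  shows "optimal_pairs x y"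
  unfolding optimal_pairs_def min_weight_perfect_matching_def
proof (intro conjI allI impI assms(1-3))
  fix n
  show pm: "perfect_matching (x ` {..<n} \<union> y ` {..<n}) n x y"
  proof (rule perfect_matchingI)
    show "inj_on x {..<n}" "inj_on y {..<n}" using assms(1,2) by (simp_all add: inj_on_def inj_def)
    show "x ` {..<n} \<inter> y ` {..<n} = {}" using assms(3) by blast
  qed
  fix u v assume uv: "perfect_matching (x ` {..<n} \<union> y ` {..<n}) n u v"
  have "matching_weight n x y \<le> matching_weight n u v + real n * (0::real)"
  proof (rule matching_weight_le_if_potential[OF pm uv])
    fix i assume "i < n"
    then show "R (u i) + R (v i) \<le> dist (u i) (v i)"
      using uv by (intro assms(5)) (auto simp: perfect_matching_def)
  qed (simp add: assms(4))
  then show "matching_weight n x y \<le> matching_weight n u v" by simp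
qed

section \<open>Optimal pairs from sequences and from small distances\<close>

text \<open>With \<open>D m n = R m + R n - dist (z m) (z n)\<close>, minimizing the weight means maximizing the total
  defect \<open>D\<close>. If \<open>D\<close> vanishes on a tail, all matchings there have the same weight. Otherwise pairs with
  positive defect \<open>s k\<close> are chosen so far apart that every defect between an earlier pair \<open>k\<close> and later
  points is at most \<open>s k / 2\<close>; lowering \<open>R\<close> by \<open>s k / 2\<close> at both ends of pair \<open>k\<close> then makes it a
  potential that is exact on the chosen pairs.\<close>

lemma optimal_pairs_if_asymptotic_potential:
  fixes z :: "nat \<Rightarrow> 'a::metric_space"
  assumes inj: "inj z"
    and le: "\<And>m n. m \<noteq> n \<Longrightarrow> dist (z m) (z n) \<le> R m + R n"
    and lim: "\<And>m. (\<lambda>n. R m + R n - dist (z m) (z n)) \<longlonglongrightarrow> 0"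
  shows "\<exists>x y :: nat \<Rightarrow> 'a. optimal_pairs x y"
proof -
  define D where "D m n = R m + R n - dist (z m) (z n)" for m n
  have Dsym: "D m n = D n m" for m n by (simp add: D_def dist_commute)
  have Dnn: "0 \<le> D m n" if "m \<noteq> n" for m n using le[OF that] by (simp add: D_def)
  obtain p q :: "nat \<Rightarrow> nat" and s :: "nat \<Rightarrow> real" where
    pq: "\<And>k. p k < q k" "\<And>k. q k < p (Suc k)" and s: "\<And>k. D (p k) (q k) = s k" "\<And>k. 0 \<le> s k"
    and small: "\<And>k i j. i \<in> {p k, q k} \<Longrightarrow> p (Suc k) \<le> j \<Longrightarrow> D i j \<le> s k / 2"
  proof (cases "\<exists>N. \<forall>m\<ge>N. \<forall>n>m. D m n = 0")
    case True
    then obtain N where N: "\<And>m n. N \<le> m \<Longrightarrow> m < n \<Longrightarrow> D m n = 0" by blast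
    show ?thesis
    proof (rule that[of "\<lambda>k. N + 2 * k" "\<lambda>k. N + 2 * k + 1" "\<lambda>_. 0"])
      fix k i j assume "i \<in> {N + 2 * k, N + 2 * k + 1}" "N + 2 * Suc k \<le> j"
      then show "D i j \<le> 0 / 2" using N[of i j] by auto
    qed (auto intro: N)
  next
    case False
    have pair: "\<exists>m n. N \<le> m \<and> m < n \<and> 0 < D m n" for N
    proof -
      obtain m n where "N \<le> m" "m < n" "D m n \<noteq> 0" using False by blast
      then show ?thesis using Dnn[of m n] by fastforce
    qed
    have tail: "\<exists>N. \<forall>j\<ge>N. D m j \<le> e" if "0 < e" for m e
    proof -
      have "\<forall>\<^sub>F j in sequentially. D m j < e"
        using order_tendstoD(2)[OF lim[of m] that] by (simp add: D_def)
      then show ?thesis by (auto simp: eventually_sequentially intro: less_imp_le)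
    qed
    have "\<exists>f. \<forall>k. (fst (f k) < snd (f k) \<and> 0 < D (fst (f k)) (snd (f k))) \<and>
        (snd (f k) < fst (f (Suc k)) \<and>
         (\<forall>i\<in>{fst (f k), snd (f k)}. \<forall>j\<ge>fst (f (Suc k)). D i j \<le> D (fst (f k)) (snd (f k)) / 2))"
    proof (rule dependent_nat_choice)
      show "\<exists>x. fst x < snd x \<and> 0 < D (fst x) (snd x)" using pair[of 0] by auto
      fix x :: "nat \<times> nat" and k :: nat
      assume x: "fst x < snd x \<and> 0 < D (fst x) (snd x)"
      then have e: "0 < D (fst x) (snd x) / 2" by simp
      obtain N1 N2 where N: "\<forall>j\<ge>N1. D (fst x) j \<le> D (fst x) (snd x) / 2"
        "\<forall>j\<ge>N2. D (snd x) j \<le> D (fst x) (snd x) / 2" using tail[OF e] by metis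
      obtain m n where mn: "max (Suc (snd x)) (max N1 N2) \<le> m" "m < n" "0 < D m n"
        using pair by blast
      show "\<exists>y. (fst y < snd y \<and> 0 < D (fst y) (snd y)) \<and> snd x < fst y \<and>
          (\<forall>i\<in>{fst x, snd x}. \<forall>j\<ge>fst y. D i j \<le> D (fst x) (snd x) / 2)"
        using mn N by (intro exI[of _ "(m, n)"]) auto
    qed
    then obtain f where f: "\<forall>k. (fst (f k) < snd (f k) \<and> 0 < D (fst (f k)) (snd (f k))) \<and>
        (snd (f k) < fst (f (Suc k)) \<and>
         (\<forall>i\<in>{fst (f k), snd (f k)}. \<forall>j\<ge>fst (f (Suc k)). D i j \<le> D (fst (f k)) (snd (f k)) / 2))"
      by blast
    show ?thesis
      by (rule that[of "fst \<circ> f" "snd \<circ> f" "\<lambda>k. D (fst (f k)) (snd (f k))"])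
        (use f in \<open>auto intro: less_imp_le\<close>)
  qed
  have mono: "q k < p l" if "k < l" for k l
    using that
  proof (induction l)
    case (Suc l)
    then show ?case using pq[of l] by (cases "k = l") (auto intro: less_trans)
  qed simp
  have pne: "p k \<noteq> p l" "q k \<noteq> q l" if "k \<noteq> l" for k l
    using that mono[of k l] mono[of l k] pq(1)[of k] pq(1)[of l] by linarith+
  have pqne: "p k \<noteq> q l" for k l
    using mono[of k l] mono[of l k] pq(1)[of k] pq(1)[of l] by (cases k l rule: linorder_cases) auto
  \<comment> \<open>The index \<open>k\<close> is unique for the chosen points, and \<open>T\<close> is evaluated only there.\<close>
  define T where "T i = R i - s (THE k. i = p k \<or> i = q k) / 2" for i
  have T: "T (p k) = R (p k) - s k / 2" "T (q k) = R (q k) - s k / 2" for k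
  proof -
    have "p k = p l \<longleftrightarrow> k = l" "q k = q l \<longleftrightarrow> k = l" "p k \<noteq> q l" "q k \<noteq> p l" for l
      using pne[of k l] pqne[of k l] pqne[of l k] by auto
    then show "T (p k) = R (p k) - s k / 2" "T (q k) = R (q k) - s k / 2"
      by (simp_all add: T_def)
  qed
  have cross: "T i + T j \<le> dist (z i) (z j)" if "i \<in> {p k, q k}" "j \<in> {p l, q l}" "k < l" for i j k l
  proof -
    have "p (Suc k) \<le> j"
    proof (cases "Suc k = l")
      case False
      then have "q (Suc k) < p l" using that(3) by (intro mono) simp
      then show ?thesis using that(2) pq(1)[of "Suc k"] pq(1)[of l] by auto
    qed (use that pq(1)[of l] in auto)
    then have "D i j \<le> s k / 2" by (rule small[OF that(1)])
    moreover have "T i = R i - s k / 2" "T j = R j - s l / 2" using that T by auto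
    ultimately show ?thesis using s(2)[of l] by (simp add: D_def)
  qed
  have edge: "dist (z (p k)) (z (q k)) = T (p k) + T (q k)" for k
    using s(1)[of k] by (simp add: T D_def field_simps)
  define S where "S v = T (the_inv z v)" for v
  have S: "S (z i) = T i" for i by (simp add: S_def the_inv_f_f inj)
  have "optimal_pairs (z \<circ> p) (z \<circ> q)"
  proof (rule optimal_pairs_if_potential[where R = S])
    show "inj (z \<circ> p)" "inj (z \<circ> q)"
      using pne by (intro inj_compose inj injI; blast)+
    show "range (z \<circ> p) \<inter> range (z \<circ> q) = {}"
      using pqne by (auto simp: inj_eq[OF inj])
    show "dist ((z \<circ> p) i) ((z \<circ> q) i) \<le> S ((z \<circ> p) i) + S ((z \<circ> q) i)" for i
      by (simp add: S edge)
    fix a b assume ab: "a \<in> range (z \<circ> p) \<union> range (z \<circ> q)" "b \<in> range (z \<circ> p) \<union> range (z \<circ> q)" "a \<noteq> b"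
    obtain i j k l where ij: "a = z i" "b = z j" "i \<in> {p k, q k}" "j \<in> {p l, q l}"
      using ab by auto
    show "S a + S b \<le> dist a b"
    proof (cases k l rule: linorder_cases)
      case less
      then show ?thesis using cross[OF ij(3,4)] by (simp add: ij S)
    next
      case equal
      then have "(i = p k \<and> j = q k) \<or> (i = q k \<and> j = p k)" using ij ab(3) by auto
      then show ?thesis using edge[of k] by (auto simp: ij S dist_commute)
    next
      case greater
      then show ?thesis using cross[OF ij(4,3)] by (simp add: ij S dist_commute add.commute)
    qed
  qed
  then show ?thesis by blast
qed

text \<open>Here \<open>R m\<close> is the distance from \<open>z m\<close> to the limit of \<open>z\<close> in the completion: the defect is nonnegative
  by the triangle inequality, and it tends to 0 because \<open>R\<close> does.\<close>

lemma optimal_pairs_if_Cauchy: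
  fixes z :: "nat \<Rightarrow> 'a::metric_space"
  assumes "inj z" "Cauchy z"
  shows "\<exists>x y :: nat \<Rightarrow> 'a. optimal_pairs x y"
proof -
  have "Cauchy (\<lambda>n. dist (z m) (z n))" for m
  proof (rule metric_CauchyI)
    fix e :: real assume "0 < e"
    then obtain N where N: "\<forall>k\<ge>N. \<forall>n\<ge>N. dist (z k) (z n) < e"
      using assms(2) by (meson metric_CauchyD)
    have "dist (dist (z m) (z k)) (dist (z m) (z n)) < e" if "k \<ge> N" "n \<ge> N" for k n
      using N that abs_dist_diff_le[of "z k" "z m" "z n"]
      by (simp add: dist_real_def dist_commute) (meson order_le_less_trans)
    then show "\<exists>N. \<forall>k\<ge>N. \<forall>n\<ge>N. dist (dist (z m) (z k)) (dist (z m) (z n)) < e" by blast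
  qed
  then have "\<exists>r. (\<lambda>n. dist (z m) (z n)) \<longlonglongrightarrow> r" for m
    by (simp add: Cauchy_convergent_iff convergent_def)
  then obtain R where R: "\<And>m. (\<lambda>n. dist (z m) (z n)) \<longlonglongrightarrow> R m" by metis
  have "R \<longlonglongrightarrow> 0"
  proof (rule LIMSEQ_I)
    fix e :: real assume "0 < e"
    then have "0 < e / 2" by simp
    then obtain N where N: "\<forall>k\<ge>N. \<forall>n\<ge>N. dist (z k) (z n) < e / 2"
      using assms(2) by (meson metric_CauchyD)
    have "norm (R m - 0) < e" if "m \<ge> N" for m
    proof -
      have "R m \<le> e / 2"
        by (rule LIMSEQ_le_const2[OF R]) (use N that in \<open>auto intro!: exI[of _ N] less_imp_le\<close>)
      moreover have "0 \<le> R m" by (rule LIMSEQ_le_const[OF R]) auto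
      ultimately show ?thesis using \<open>0 < e\<close> by simp
    qed
    then show "\<exists>N. \<forall>m\<ge>N. norm (R m - 0) < e" by blast
  qed
  show ?thesis
  proof (rule optimal_pairs_if_asymptotic_potential[OF assms(1)])
    show "dist (z m) (z n) \<le> R m + R n" for m n
      by (rule LIMSEQ_le_const[OF tendsto_add[OF R R]]) (auto simp: dist_triangle2)
    show "(\<lambda>n. R m + R n - dist (z m) (z n)) \<longlonglongrightarrow> 0" for m
      using tendsto_diff[OF tendsto_add[OF tendsto_const[of "R m"] \<open>R \<longlonglongrightarrow> 0\<close>] R[of m]] by simp
  qed
qed

lemma tendsto_zero_if_geometric_decay:
  fixes r :: "nat \<Rightarrow> real"
  assumes "\<And>n. 0 \<le> r n" "\<And>n. r (Suc n) \<le> c * r n" "0 \<le> c" "c < 1"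
  shows "r \<longlonglongrightarrow> 0"
proof (rule Lim_null_comparison)
  have "r n \<le> c ^ n * r 0" for n
  proof (induction n)
    case (Suc n)
    then show ?case using assms(2)[of n] mult_left_mono[OF Suc assms(3)] by (simp add: mult.assoc)
  qed simp
  then show "\<forall>\<^sub>F n in sequentially. norm (r n) \<le> c ^ n * r 0" using assms(1) by simp
  show "(\<lambda>n. c ^ n * r 0) \<longlonglongrightarrow> 0"
    using tendsto_mult_right[OF LIMSEQ_realpow_zero[OF assms(3,4)], of "r 0"] by simp
qed

lemma inj_Cauchy_if_islimpt:
  fixes p :: "'a::metric_space"
  assumes "p islimpt UNIV"
  shows "\<exists>z :: nat \<Rightarrow> 'a. inj z \<and> Cauchy z"
proof -
  have near: "\<exists>q. q \<noteq> p \<and> dist q p < e" if "0 < e" for e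
    using assms that unfolding islimpt_approachable by blast
  have "\<exists>z. \<forall>n::nat. z n \<noteq> p \<and> dist (z (Suc n)) p < dist (z n) p / 2"
  proof (rule dependent_nat_choice)
    fix q and n :: nat assume "q \<noteq> p"
    then show "\<exists>q'. q' \<noteq> p \<and> dist q' p < dist q p / 2" using near[of "dist q p / 2"] by simp
  qed (use near[of 1] in auto)
  then obtain z where z: "\<And>n::nat. z n \<noteq> p" "\<And>n. dist (z (Suc n)) p < dist (z n) p / 2" by blast
  have "dist (z (Suc n)) p < dist (z n) p" for n
    using z(2)[of n] zero_le_dist[of "z n" p] by linarith
  then have "inj (\<lambda>n. - dist (z n) p)"
    by (intro strict_mono_imp_inj_on) (simp add: strict_mono_Suc_iff)
  then have "inj z" by (auto simp: inj_def)
  moreover have "(\<lambda>n. dist (z n) p) \<longlonglongrightarrow> 0"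
    by (rule tendsto_zero_if_geometric_decay[of _ "1 / 2"]) (use z(2) in \<open>auto intro: less_imp_le\<close>)
  then have "z \<longlonglongrightarrow> p" by (simp add: tendsto_dist_iff[symmetric])
  ultimately show ?thesis using LIMSEQ_imp_Cauchy by blast
qed

text \<open>Let \<open>\<rho> p\<close> be the distance from \<open>p\<close> to the other points. Going repeatedly from a point to an almost
  nearest neighbour with a substantially smaller \<open>\<rho>\<close> would give an injective Cauchy sequence. If there is none,
  this descent stops, at a pair that is at most slightly farther apart than the values of \<open>\<rho>\<close> at both its ends.
  Such pairs, of rapidly decreasing lengths \<open>d k\<close>, are far from each other relative to their
  lengths, so that half the length of its pair is a potential at each end.\<close>

lemma optimal_pairs_if_not_uniformly_discrete:
  assumes "\<And>e. 0 < e \<Longrightarrow> \<exists>u v :: 'a::metric_space. u \<noteq> v \<and> dist u v < e"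
  shows "\<exists>x y :: nat \<Rightarrow> 'a. optimal_pairs x y"
proof (cases "\<exists>z :: nat \<Rightarrow> 'a. inj z \<and> Cauchy z")
  case True
  then show ?thesis using optimal_pairs_if_Cauchy by blast
next
  case False
  define \<rho> where "\<rho> p = infdist p (UNIV - {p})" for p :: 'a
  have ne: "UNIV - {p} \<noteq> {}" for p :: 'a
  proof -
    obtain u v :: 'a where "u \<noteq> v" using assms[of 1] by auto
    then show ?thesis by (cases "u = p") auto
  qed
  have \<rho>_le: "\<rho> p \<le> dist p q" if "p \<noteq> q" for p q
    unfolding \<rho>_def using that by (intro infdist_le) auto
  have \<rho>_less: "\<exists>q. q \<noteq> p \<and> dist p q < r" if "\<rho> p < r" for p r
  proof -
    have bdd: "bdd_below (dist p ` (UNIV - {p}))" by (rule bdd_belowI[of _ 0]) auto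
    have "(INF q\<in>UNIV - {p}. dist p q) < r"
      using that ne[of p] by (simp add: \<rho>_def infdist_def)
    then have "\<exists>q\<in>UNIV - {p}. dist p q < r" by (simp only: cINF_less_iff[OF ne bdd])
    then show ?thesis by auto
  qed
  have \<rho>_pos: "0 < \<rho> p" for p
  proof (rule ccontr)
    assume "\<not> 0 < \<rho> p"
    moreover have "0 \<le> \<rho> p" by (simp add: \<rho>_def infdist_nonneg)
    ultimately have "\<rho> p = 0" by simp
    then have "p islimpt UNIV"
      unfolding islimpt_approachable using \<rho>_less[of p] by (auto simp: dist_commute)
    then show False using False inj_Cauchy_if_islimpt by blast
  qed
  \<comment> \<open>A neighbour \<open>q\<close> of \<open>p\<close> with \<open>dist p q < 11/10 * \<rho> p\<close> satisfies the condition on \<open>\<rho> p\<close>, as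
    \<open>8/10 * 11/10 < 1\<close>; if it fails the condition on \<open>\<rho> q\<close>, then \<open>\<rho> q < 88/100 * \<rho> p\<close>.\<close>
  have good: "\<exists>p q. p \<noteq> q \<and> dist p q < e \<and> 8 / 10 * dist p q \<le> \<rho> p \<and> 8 / 10 * dist p q \<le> \<rho> q"
    if "0 < e" for e
  proof (rule ccontr)
    assume no: "\<not> ?thesis"
    have step: "\<exists>q. \<rho> q < e / 2 \<and> dist p q \<le> 11 / 10 * \<rho> p \<and> \<rho> q \<le> 9 / 10 * \<rho> p" if "\<rho> p < e / 2" for p
    proof -
      obtain q where q: "q \<noteq> p" "dist p q < 11 / 10 * \<rho> p"
        using \<rho>_less[of p "11 / 10 * \<rho> p"] \<rho>_pos[of p] by auto
      have "dist p q < e" "8 / 10 * dist p q \<le> \<rho> p" using q \<rho>_pos[of p] that by auto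
      then have "\<rho> q < 8 / 10 * dist p q" using no q(1) by force
      then show ?thesis using q \<rho>_pos[of p] that by (intro exI[of _ q]) auto
    qed
    obtain u v :: 'a where "u \<noteq> v" "dist u v < e / 2" using assms[of "e / 2"] \<open>0 < e\<close> by auto
    then have "\<rho> u < e / 2" using \<rho>_le[of u v] by simp
    then have "\<exists>z. \<forall>n. \<rho> (z n) < e / 2 \<and>
        (dist (z n) (z (Suc n)) \<le> 11 / 10 * \<rho> (z n) \<and> \<rho> (z (Suc n)) \<le> 9 / 10 * \<rho> (z n))"
      by (intro dependent_nat_choice) (use step in auto)
    then obtain z where z: "\<And>n. dist (z n) (z (Suc n)) \<le> 11 / 10 * \<rho> (z n)"
      "\<And>n. \<rho> (z (Suc n)) \<le> 9 / 10 * \<rho> (z n)" by blast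
    have dec: "\<rho> (z (Suc n)) < \<rho> (z n)" for n using z(2)[of n] \<rho>_pos[of "z n"] by auto
    then have "inj (\<lambda>n. - \<rho> (z n))"
      by (intro strict_mono_imp_inj_on) (simp add: strict_mono_Suc_iff)
    then have "inj z" by (auto simp: inj_def)
    have "Cauchy z"
    proof -
      \<comment> \<open>The geometric series with first term \<open>11/10 * \<rho> (z m)\<close> and ratio \<open>9/10\<close>.\<close>
      have d: "dist (z m) (z (m + k)) \<le> 11 * \<rho> (z m)" for m k
      proof (induction k arbitrary: m)
        case (Suc k)
        have "dist (z m) (z (m + Suc k)) \<le> dist (z m) (z (Suc m)) + dist (z (Suc m)) (z (Suc m + k))"
          using dist_triangle[of "z m" "z (m + Suc k)" "z (Suc m)"] by simp
        then show ?case using Suc[of "Suc m"] z(1)[of m] z(2)[of m] by simp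
      qed (use \<rho>_pos in \<open>simp add: less_imp_le\<close>)
      have lim: "(\<lambda>n. \<rho> (z n)) \<longlonglongrightarrow> 0"
        by (rule tendsto_zero_if_geometric_decay[of _ "9 / 10"])
          (use z(2) \<rho>_pos in \<open>auto intro: less_imp_le\<close>)
      show ?thesis
      proof (rule metric_CauchyI)
        fix r :: real assume "0 < r"
        then have "\<forall>\<^sub>F n in sequentially. \<rho> (z n) < r / 22"
          by (intro order_tendstoD(2)[OF lim]) simp
        then obtain N where "\<rho> (z N) < r / 22"
          by (auto simp: eventually_sequentially)
        then have r: "11 * \<rho> (z N) < r / 2" by simp
        have "dist (z m) (z n) < r" if "m \<ge> N" "n \<ge> N" for m n
        proof -
          have "dist (z N) (z m) < r / 2" "dist (z N) (z n) < r / 2"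
            using d[of N "m - N"] d[of N "n - N"] r that by auto
          then show ?thesis using dist_triangle3[of "z m" "z n" "z N"] by simp
        qed
        then show "\<exists>M. \<forall>m\<ge>M. \<forall>n\<ge>M. dist (z m) (z n) < r" by blast
      qed
    qed
    then show False using False \<open>inj z\<close> by blast
  qed
  have "\<exists>f. \<forall>k::nat. (fst (f k) \<noteq> snd (f k) \<and> 8 / 10 * dist (fst (f k)) (snd (f k)) \<le> \<rho> (fst (f k))
        \<and> 8 / 10 * dist (fst (f k)) (snd (f k)) \<le> \<rho> (snd (f k))) \<and>
      (dist (fst (f (Suc k))) (snd (f (Suc k))) < dist (fst (f k)) (snd (f k)) / 4)"
  proof (rule dependent_nat_choice)
    show "\<exists>x. fst x \<noteq> snd x \<and> 8 / 10 * dist (fst x) (snd x) \<le> \<rho> (fst x)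
        \<and> 8 / 10 * dist (fst x) (snd x) \<le> \<rho> (snd x)"
      using good[of 1] by auto
    fix x :: "'a \<times> 'a" and k :: nat
    assume "fst x \<noteq> snd x \<and> 8 / 10 * dist (fst x) (snd x) \<le> \<rho> (fst x)
        \<and> 8 / 10 * dist (fst x) (snd x) \<le> \<rho> (snd x)"
    then show "\<exists>y. (fst y \<noteq> snd y \<and> 8 / 10 * dist (fst y) (snd y) \<le> \<rho> (fst y)
        \<and> 8 / 10 * dist (fst y) (snd y) \<le> \<rho> (snd y)) \<and>
        dist (fst y) (snd y) < dist (fst x) (snd x) / 4"
      using good[of "dist (fst x) (snd x) / 4"] by auto
  qed
  then obtain f where f: "\<And>k::nat. fst (f k) \<noteq> snd (f k)"
      "\<And>k. 8 / 10 * dist (fst (f k)) (snd (f k)) \<le> \<rho> (fst (f k))"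
      "\<And>k. 8 / 10 * dist (fst (f k)) (snd (f k)) \<le> \<rho> (snd (f k))"
      "\<And>k. dist (fst (f (Suc k))) (snd (f (Suc k))) < dist (fst (f k)) (snd (f k)) / 4" by blast
  define x y where "x k = fst (f k)" and "y k = snd (f k)" for k
  define d where "d k = dist (x k) (y k)" for k
  have xy: "x k \<noteq> y k" for k using f(1) by (simp add: x_def y_def)
  have dpos: "0 < d k" for k using xy by (simp add: d_def)
  have \<rho>: "8 / 10 * d k \<le> \<rho> a" if "a \<in> {x k, y k}" for k a
    using f(2,3)[of k] that by (auto simp: d_def x_def y_def)
  have dSuc: "d (Suc k) < d k / 4" for k using f(4) by (simp add: d_def x_def y_def)
  have dless: "d l < d k / 4" if "k < l" for k l
    using that
  proof (induction l)
    case (Suc l)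
    then show ?case using dSuc[of l] dpos[of l] by (cases "k = l") auto
  qed simp
  have ne2: "a \<noteq> b" if "a \<in> {x k, y k}" "b \<in> {x l, y l}" "k < l" for a b k l
  proof
    assume "a = b"
    have "\<rho> b \<le> d l" using that(2) \<rho>_le[OF xy[of l]] \<rho>_le[OF xy[of l, symmetric]]
      by (auto simp: d_def dist_commute)
    then show False using \<rho>[OF that(1)] dless[OF that(3)] dpos[of k] \<open>a = b\<close> by auto
  qed
  \<comment> \<open>Since \<open>d l < d k / 4\<close>, the left side is at most \<open>5/8 * d k\<close>, below \<open>8/10 * d k \<le> \<rho> a\<close>.\<close>
  have cross: "d k / 2 + d l / 2 \<le> dist a b" if "a \<in> {x k, y k}" "b \<in> {x l, y l}" "k < l" for a b k l
    using \<rho>_le[OF ne2[OF that]] \<rho>[OF that(1)] dless[OF that(3)] dpos[of k] by auto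
  have ne3: "a \<noteq> b" if "a \<in> {x k, y k}" "b \<in> {x l, y l}" "k \<noteq> l" for a b k l
    using that ne2[of a k b l] ne2[of b l a k] by (metis nat_neq_iff)
  define R where "R a = d (THE k. a \<in> {x k, y k}) / 2" for a
  have R: "R a = d k / 2" if "a \<in> {x k, y k}" for a k
  proof -
    have "(THE k. a \<in> {x k, y k}) = k" using that ne3[of a _ a k] by (intro the_equality) metis+
    then show ?thesis by (simp add: R_def)
  qed
  have "optimal_pairs x y"
  proof (rule optimal_pairs_if_potential[where R = R])
    show "inj x" "inj y" using ne3 by (meson injI insertI1 insertI2)+
    have "x k \<noteq> y l" for k l using ne3[of "x k" k "y l" l] xy[of k] by (cases "k = l") auto
    then show "range x \<inter> range y = {}" by auto
    show "dist (x i) (y i) \<le> R (x i) + R (y i)" for i by (simp add: R[of _ i]) (simp add: d_def)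
    fix a b assume ab: "a \<in> range x \<union> range y" "b \<in> range x \<union> range y" "a \<noteq> b"
    have "\<exists>k. c \<in> {x k, y k}" if "c \<in> range x \<union> range y" for c using that by auto
    then obtain k l where kl: "a \<in> {x k, y k}" "b \<in> {x l, y l}" using ab by meson
    show "R a + R b \<le> dist a b"
    proof (cases k l rule: linorder_cases)
      case less
      then show ?thesis using cross[OF kl] R[OF kl(1)] R[OF kl(2)] by simp
    next
      case equal
      then have "dist a b = d k" using kl ab(3) by (auto simp: d_def dist_commute)
      then show ?thesis using R[OF kl(1)] R[OF kl(2)] equal by simp
    next
      case greater
      then show ?thesis using cross[OF kl(2,1)] R[OF kl(1)] R[OF kl(2)] by (simp add: dist_commute)
    qed
  qed
  then show ?thesis by blast
qed

section \<open>Pairing transportation problems with functions\<close>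

text \<open>The linear functional on transportation problems that a function \<open>g\<close> induces; adding a constant
  to \<open>g\<close> does not change it.\<close>

definition pairing :: "('a \<Rightarrow> real) \<Rightarrow> 'a TP \<Rightarrow> real" where
  "pairing g h = (\<Sum>v | TP_fun h v \<noteq> 0. TP_fun h v * g v)"

abbreviation lip1 :: "('a::metric_space \<Rightarrow> real) \<Rightarrow> bool" where
  "lip1 g \<equiv> \<forall>u v. g u - g v \<le> dist u v"

lemma finite_TP_fun: "finite {v. TP_fun h v \<noteq> 0}"
  and sum_TP_fun: "(\<Sum>v | TP_fun h v \<noteq> 0. TP_fun h v) = 0"
  using TP_fun[of h] by auto

lemma pairing_superset:
  assumes "finite S" "{v. TP_fun h v \<noteq> 0} \<subseteq> S"
  shows "pairing g h = (\<Sum>v\<in>S. TP_fun h v * g v)"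
  unfolding pairing_def by (rule sum.mono_neutral_left) (use assms in auto)

lemma linear_pairing: "linear (pairing g)"
proof (rule linearI)
  fix h k :: "'a TP" and r :: real
  let ?S = "{v. TP_fun h v \<noteq> 0} \<union> {v. TP_fun k v \<noteq> 0}"
  have fin: "finite ?S" by (simp add: finite_TP_fun)
  have "{v. TP_fun (h + k) v \<noteq> 0} \<subseteq> ?S" by (auto simp: plus_TP.rep_eq)
  then show "pairing g (h + k) = pairing g h + pairing g k"
    by (simp add: pairing_superset[OF fin] plus_TP.rep_eq sum.distrib[symmetric] algebra_simps)
  have "{v. TP_fun (r *\<^sub>R h) v \<noteq> 0} \<subseteq> {v. TP_fun h v \<noteq> 0}" by (auto simp: scaleR_TP.rep_eq)
  then show "pairing g (r *\<^sub>R h) = r *\<^sub>R pairing g h"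
    by (simp add: pairing_superset[OF finite_TP_fun[of h]] scaleR_TP.rep_eq sum_distrib_left
        algebra_simps)
qed

lemma pairing_add_left: "pairing (\<lambda>v. f v + g v) h = pairing f h + pairing g h"
  by (simp add: pairing_def sum.distrib algebra_simps)

lemma pairing_cmult_left: "pairing (\<lambda>v. c * g v) h = c * pairing g h"
  by (simp add: pairing_def sum_distrib_left algebra_simps)

lemma pairing_sum_left: "pairing (\<lambda>v. \<Sum>i\<in>I. f i v) h = (\<Sum>i\<in>I. pairing (f i) h)"
  unfolding pairing_def sum_distrib_left by (rule sum.swap)

text \<open>Weak duality: moving a unit of mass from \<open>x\<close> to \<open>y\<close> changes the pairing by at most \<open>dist x y\<close>.\<close>

lemma pairing_le_norm:
  assumes "lip1 g"
  shows "pairing g h \<le> norm h"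
  unfolding norm_TP.rep_eq TC_norm_def
proof (rule cInf_greatest)
  show "{plan_cost n a x y | n a x y. transportation_plan (TP_fun h) n a x y} \<noteq> {}"
    using transportation_plan_exists[OF finite_TP_fun sum_TP_fun, of h] by blast
  fix c assume "c \<in> {plan_cost n a x y | n a x y. transportation_plan (TP_fun h) n a x y}"
  then obtain n a x y where c: "c = plan_cost n a x y"
    and p: "transportation_plan (TP_fun h) n a x y" by blast
  have "(\<Sum>i<n. a i * (g (x i) - g (y i))) \<le> c"
    unfolding c plan_cost_def using p assms
    by (intro sum_mono mult_left_mono) (auto simp: transportation_plan_def)
  then show "pairing g h \<le> c"
    using transportation_plan_duality[OF p finite_TP_fun, of g] by (simp add: pairing_def)
qed

lemma abs_pairing_le_norm:
  assumes "lip1 g"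
  shows "\<bar>pairing g h\<bar> \<le> norm h"
  using pairing_le_norm[OF assms, of h] pairing_le_norm[OF assms, of "- h"]
  by (simp add: linear_neg[OF linear_pairing] abs_le_iff)

lift_definition molecule :: "'a \<Rightarrow> 'a \<Rightarrow> 'a TP" is
  "\<lambda>u v w. indicator {u} w - indicator {v} w"
proof -
  fix u v :: 'a
  have sub: "{w. (indicator {u} w - indicator {v} w :: real) \<noteq> 0} \<subseteq> {u, v}"
    by (auto simp: indicator_def)
  then have "(\<Sum>w | (indicator {u} w - indicator {v} w :: real) \<noteq> 0. indicator {u} w - indicator {v} w)
      = (\<Sum>w\<in>{u, v}. indicator {u} w - indicator {v} w :: real)"
    by (intro sum.mono_neutral_left) auto
  also have "\<dots> = 0" by (cases "u = v") (simp_all add: indicator_def)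
  finally show "finite {w. (indicator {u} w - indicator {v} w :: real) \<noteq> 0} \<and>
      (\<Sum>w | (indicator {u} w - indicator {v} w :: real) \<noteq> 0. indicator {u} w - indicator {v} w) = (0::real)"
    using finite_subset[OF sub] by simp
qed

lemma pairing_molecule: "pairing g (molecule u v) = g u - g v"
proof -
  have "pairing g (molecule u v) = (\<Sum>w\<in>{u, v}. TP_fun (molecule u v) w * g w)"
    by (rule pairing_superset) (auto simp: molecule.rep_eq indicator_def)
  then show ?thesis by (cases "u = v") (simp_all add: molecule.rep_eq indicator_def)
qed

lemma norm_molecule_le: "norm (molecule u v) \<le> dist u v"
proof -
  have "transportation_plan (TP_fun (molecule u v)) 1 (\<lambda>_. 1) (\<lambda>_. u) (\<lambda>_. v)"
    by (simp add: transportation_plan_def molecule.rep_eq fun_eq_iff)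
  from TC_norm_le[OF this] show ?thesis by (simp add: norm_TP.rep_eq plan_cost_def)
qed

section \<open>Optimal pairs span isometric copies of the sequence space\<close>

lemma sum_cycle_eq_sum_permutation:
  assumes "distinct cs"
  shows "\<exists>\<sigma>. \<sigma> permutes set cs \<and>
    sum_list (map2 w (cs @ [hd cs]) (tl (cs @ [hd cs]))) = (\<Sum>k\<in>set cs. w k (\<sigma> k) :: real)"
proof (cases "cs = []")
  case False
  let ?\<sigma> = "cycle_of_list cs"
  have "map ?\<sigma> cs = rotate1 cs"
    using cyclic_rotation[OF assms, of 1] by simp
  also have "\<dots> = tl (cs @ [hd cs])" using False by (cases cs) auto
  finally have t: "tl (cs @ [hd cs]) = map ?\<sigma> cs" by simp
  have "zip (cs @ [hd cs]) (tl (cs @ [hd cs])) = zip cs (map ?\<sigma> cs)"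
    unfolding t by (simp add: zip_append1)
  then have "sum_list (map2 w (cs @ [hd cs]) (tl (cs @ [hd cs]))) = sum_list (map (\<lambda>k. w k (?\<sigma> k)) cs)"
    by (simp add: zip_map2 zip_same_conv_map comp_def)
  then show ?thesis
    using cycle_permutes[of cs] assms by (auto simp: sum_list_distinct_conv_sum_set)
qed (auto intro: permutes_id)

text \<open>Take for \<open>p i\<close> the length of a shortest simple path from \<open>i\<close>; there are only finitely many simple
  paths. Prepending \<open>i\<close> to a shortest path from \<open>j\<close> gives the inequality if \<open>i\<close> is not on that path.
  If it is, the edge from \<open>i\<close> to \<open>j\<close> closes a simple cycle, which has nonnegative length because it
  extends by the identity to a permutation, and the rest of the path starts at \<open>i\<close>.\<close>

lemma cyclically_monotone_potential:
  fixes w :: "'i \<Rightarrow> 'i \<Rightarrow> real"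
  assumes "finite I" and diag: "\<And>i. i \<in> I \<Longrightarrow> w i i = 0"
    and cyc: "\<And>\<sigma>. \<sigma> permutes I \<Longrightarrow> 0 \<le> (\<Sum>i\<in>I. w i (\<sigma> i))"
  obtains p :: "'i \<Rightarrow> real" where "\<And>i j. i \<in> I \<Longrightarrow> j \<in> I \<Longrightarrow> p i \<le> w i j + p j"
proof -
  define len where "len ps = sum_list (map2 w ps (tl ps))" for ps
  have cycle: "0 \<le> len (cs @ [hd cs])" if cs: "distinct cs" "set cs \<subseteq> I" for cs
  proof -
    obtain \<sigma> where \<sigma>: "\<sigma> permutes set cs" "len (cs @ [hd cs]) = (\<Sum>k\<in>set cs. w k (\<sigma> k))"
      using sum_cycle_eq_sum_permutation[OF cs(1), of w] by (auto simp: len_def)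
    have "(\<Sum>k\<in>set cs. w k (\<sigma> k)) = (\<Sum>k\<in>I. w k (\<sigma> k))"
      using cs(2) assms(1) permutes_not_in[OF \<sigma>(1)] by (intro sum.mono_neutral_left) (auto simp: diag)
    then show ?thesis using cyc[OF permutes_subset[OF \<sigma>(1) cs(2)]] \<sigma>(2) by simp
  qed
  define P where "P i = {i # l | l. distinct (i # l) \<and> set (i # l) \<subseteq> I}" for i
  have finP: "finite (P i)" for i
    by (rule finite_subset[OF _ finite_subset_distinct[OF assms(1)]]) (auto simp: P_def)
  have len_app: "len (xs @ i # ys) = len (xs @ [i]) + len (i # ys)" for xs i ys
  proof (induction xs)
    case (Cons x xs)
    then show ?case by (cases xs) (simp_all add: len_def)
  qed (simp add: len_def)
  define p where "p i = Min (len ` P i)" for i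
  show ?thesis
  proof (rule that[of p])
    fix i j assume ij: "i \<in> I" "j \<in> I"
    have le: "p i \<le> len (i # l)" if "distinct (i # l)" "set (i # l) \<subseteq> I" for l
      unfolding p_def using that finP[of i] by (intro Min_le finite_imageI) (auto simp: P_def)
    have "[j] \<in> P j" using ij by (auto simp: P_def)
    then have "p j \<in> len ` P j" unfolding p_def using finP by (intro Min_in) auto
    then obtain l where l: "distinct (j # l)" "set (j # l) \<subseteq> I" "p j = len (j # l)"
      by (auto simp: P_def)
    show "p i \<le> w i j + p j"
    proof (cases "i \<in> set (j # l)")
      case False
      then have "p i \<le> len (i # j # l)" using l ij by (intro le) auto
      then show ?thesis using l(3) by (simp add: len_def)
    next
      case True
      show ?thesis
      proof (cases "i = j")
        case False
        then obtain l1 l2 where l12: "l = l1 @ i # l2" using True by (auto dest: split_list)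
        have "0 \<le> len ((i # j # l1) @ [i])" using cycle[of "i # j # l1"] l l12 ij False by auto
        then have "0 \<le> w i j + len ((j # l1) @ [i])" by (simp add: len_def)
        moreover have "p j = len ((j # l1) @ [i]) + len (i # l2)"
          using l(3) len_app[of "j # l1" i l2] l12 by simp
        moreover have "p i \<le> len (i # l2)" using l l12 by (intro le) auto
        ultimately show ?thesis by linarith
      qed (use ij diag in simp)
    qed
  qed
qed

lemma lip1_Min:
  assumes "finite S" "S \<noteq> {}"
  shows "lip1 (\<lambda>v. Min ((\<lambda>s. c s + dist v (t s)) ` S))"
proof (intro allI)
  fix u v
  let ?m = "\<lambda>v. Min ((\<lambda>s. c s + dist v (t s)) ` S)"
  have "?m v \<in> (\<lambda>s. c s + dist v (t s)) ` S" using assms by (intro Min_in) auto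
  then obtain s where s: "s \<in> S" "?m v = c s + dist v (t s)" by auto
  have "?m u \<le> c s + dist u (t s)" using assms s(1) by (intro Min_le) auto
  also have "\<dots> \<le> c s + (dist u v + dist v (t s))" by (simp add: dist_triangle)
  finally show "?m u - ?m v \<le> dist u v" using s(2) by simp
qed

text \<open>Let \<open>X i, Y i\<close> be the ends of the \<open>i\<close>-th edge, in the order prescribed by the sign. For a permutation \<open>\<sigma>\<close>,
  the edges \<open>X i, Y (\<sigma> i)\<close> form another perfect matching of the same points, so the costs
  \<open>dist (X i) (Y j) - dist (X i) (Y i)\<close> are cyclically monotone. A potential \<open>p\<close> for them prescribes
  values at the points \<open>Y i\<close>; the largest 1-Lipschitz function below these values norms all edges.\<close>

lemma norming_function_of_minimal_matching:
  fixes x y :: "nat \<Rightarrow> 'a::metric_space" and pos :: "nat \<Rightarrow> bool"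
  assumes "min_weight_perfect_matching V n x y"
  obtains g where "lip1 g"
    "\<And>i. i < n \<Longrightarrow> dist (x i) (y i) \<le> (if pos i then g (x i) - g (y i) else g (y i) - g (x i))"
proof (cases "n = 0")
  case False
  define X where "X i = (if pos i then x i else y i)" for i
  define Y where "Y i = (if pos i then y i else x i)" for i
  have pm: "perfect_matching V n x y" using assms by (simp add: min_weight_perfect_matching_def)
  have pmXY: "perfect_matching V n X Y"
    using pm unfolding perfect_matching_def X_def Y_def by (auto split: if_splits)
  note e = perfect_matching_ends[OF pmXY]
  define w where "w i j = dist (X i) (Y j) - dist (X i) (Y i)" for i j
  have d: "dist (X i) (Y i) = dist (x i) (y i)" for i by (simp add: X_def Y_def dist_commute)
  have cyc: "0 \<le> (\<Sum>i\<in>{..<n}. w i (\<sigma> i))" if "\<sigma> permutes {..<n}" for \<sigma>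
  proof -
    have im: "(Y \<circ> \<sigma>) ` {..<n} = Y ` {..<n}" using permutes_image[OF that] by (metis image_comp)
    have "perfect_matching (X ` {..<n} \<union> (Y \<circ> \<sigma>) ` {..<n}) n X (Y \<circ> \<sigma>)"
    proof (rule perfect_matchingI[OF e(1)])
      show "inj_on (Y \<circ> \<sigma>) {..<n}"
        using e(2) permutes_image[OF that] permutes_inj_on[OF that] by (intro comp_inj_on) auto
      show "X ` {..<n} \<inter> (Y \<circ> \<sigma>) ` {..<n} = {}" unfolding im by (rule e(3))
    qed
    then have "matching_weight n x y \<le> matching_weight n X (Y \<circ> \<sigma>)"
      using assms e(4) unfolding im min_weight_perfect_matching_def by auto
    then show ?thesis by (simp add: matching_weight_def w_def d sum_subtractf)
  qed
  obtain p where p: "\<And>i j. i \<in> {..<n} \<Longrightarrow> j \<in> {..<n} \<Longrightarrow> p i \<le> w i j + p j"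
    using cyclically_monotone_potential[of "{..<n}" w] cyc by (auto simp: w_def)
  define g where "g v = Min ((\<lambda>j. p j + dist v (Y j)) ` {..<n})" for v
  show ?thesis
  proof (rule that[of g])
    show "lip1 g" unfolding g_def using False by (intro lip1_Min) auto
    fix i assume i: "i < n"
    have "g (Y i) \<le> p i + dist (Y i) (Y i)" unfolding g_def using i by (intro Min_le image_eqI[of _ _ i]) auto
    moreover have "p i + dist (X i) (Y i) \<le> g (X i)"
      unfolding g_def using p[of i] i by (subst Min_ge_iff) (fastforce simp: w_def)+
    ultimately have "dist (x i) (y i) \<le> g (X i) - g (Y i)" by (simp add: d)
    then show "dist (x i) (y i) \<le> (if pos i then g (x i) - g (y i) else g (y i) - g (x i))"
      by (simp add: X_def Y_def split: if_splits)
  qed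
qed (use that[of "\<lambda>_. 0"] in simp)

lemma norm_sum_molecules_of_minimal_matching:
  assumes "min_weight_perfect_matching V n x y"
  shows "norm (\<Sum>i<n. a i *\<^sub>R (inverse (dist (x i) (y i)) *\<^sub>R molecule (x i) (y i))) = (\<Sum>i<n. \<bar>a i\<bar>)"
    (is "norm (\<Sum>i<n. a i *\<^sub>R ?f i) = _")
proof (rule antisym)
  have ne: "dist (x i) (y i) \<noteq> 0" if "i < n" for i
    using assms that by (auto simp: min_weight_perfect_matching_def perfect_matching_def)
  have "norm (a i *\<^sub>R ?f i) \<le> \<bar>a i\<bar>" if "i < n" for i
  proof -
    have "inverse (dist (x i) (y i)) * norm (molecule (x i) (y i)) \<le>
        inverse (dist (x i) (y i)) * dist (x i) (y i)"
      by (intro mult_left_mono norm_molecule_le) simp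
    then have "norm (?f i) \<le> 1" using ne[OF that] by simp
    then show ?thesis using mult_left_mono[of "norm (?f i)" 1 "\<bar>a i\<bar>"] by (simp del: scaleR_scaleR)
  qed
  then show "norm (\<Sum>i<n. a i *\<^sub>R ?f i) \<le> (\<Sum>i<n. \<bar>a i\<bar>)"
    by (intro sum_norm_le) simp
  obtain g where g: "lip1 g" "\<And>i. i < n \<Longrightarrow>
      dist (x i) (y i) \<le> (if 0 \<le> a i then g (x i) - g (y i) else g (y i) - g (x i))"
    using norming_function_of_minimal_matching[OF assms, of "\<lambda>i. 0 \<le> a i"] by blast
  have "\<bar>a i\<bar> \<le> a i * ((g (x i) - g (y i)) / dist (x i) (y i))" if "i < n" for i
  proof (cases "0 \<le> a i")
    case True
    have "1 \<le> (g (x i) - g (y i)) / dist (x i) (y i)"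
      using g(2)[OF that] ne[OF that] True by (simp add: le_divide_eq)
    then show ?thesis using mult_left_mono[OF _ True, of 1] True by fastforce
  next
    case False
    have "1 \<le> (g (y i) - g (x i)) / dist (x i) (y i)"
      using g(2)[OF that] ne[OF that] False by (simp add: le_divide_eq)
    then have "- a i * 1 \<le> - a i * ((g (y i) - g (x i)) / dist (x i) (y i))"
      using False by (intro mult_left_mono) auto
    then show ?thesis using False by (simp add: algebra_simps diff_divide_distrib)
  qed
  then have "(\<Sum>i<n. \<bar>a i\<bar>) \<le> (\<Sum>i<n. a i * ((g (x i) - g (y i)) / dist (x i) (y i)))"
    by (intro sum_mono) simp
  also have "\<dots> = pairing g (\<Sum>i<n. a i *\<^sub>R ?f i)"
    by (simp add: linear_sum[OF linear_pairing] linear_scale[OF linear_pairing] pairing_molecule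
        divide_inverse ac_simps)
  also have "\<dots> \<le> norm (\<Sum>i<n. a i *\<^sub>R ?f i)" by (rule pairing_le_norm[OF g(1)])
  finally show "(\<Sum>i<n. \<bar>a i\<bar>) \<le> norm (\<Sum>i<n. a i *\<^sub>R ?f i)" .
qed

text \<open>The isometry is \<open>s \<mapsto> \<Sum>i. s i * e i\<close>, which converges absolutely in a Banach space.\<close>

lemma isometry_from_ell1:
  fixes e :: "nat \<Rightarrow> 'b::banach"
  assumes "\<And>a n. norm (\<Sum>i<n. a i *\<^sub>R e i) = (\<Sum>i<n. \<bar>a i\<bar>)"
  shows "\<exists>T :: ell1 \<Rightarrow> 'b. linear T \<and> (\<forall>s. norm (T s) = norm s)"
proof -
  have ne: "norm (e i) = 1" for i
  proof -
    have "(\<Sum>j<Suc i. (if j = i then 1 else 0) *\<^sub>R e j) = e i" by (simp add: sum.delta')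
    moreover have "(\<Sum>j<Suc i. \<bar>if j = i then 1 else 0 :: real\<bar>) = 1" by (simp add: sum.delta')
    ultimately show ?thesis using assms[of "\<lambda>j. if j = i then 1 else 0" "Suc i"] by simp
  qed
  have sm: "summable (\<lambda>i. ell1_nth s i *\<^sub>R e i)" and sa: "summable (\<lambda>i. \<bar>ell1_nth s i\<bar>)" for s
  proof -
    show sa: "summable (\<lambda>i. \<bar>ell1_nth s i\<bar>)" using ell1_nth[of s] by simp
    show "summable (\<lambda>i. ell1_nth s i *\<^sub>R e i)"
      by (rule summable_norm_cancel) (simp add: ne sa)
  qed
  define T where "T s = (\<Sum>i. ell1_nth s i *\<^sub>R e i)" for s
  have "linear T"
  proof (rule linearI)
    show "T (s + t) = T s + T t" for s t
      by (simp add: T_def plus_ell1.rep_eq scaleR_add_left suminf_add[OF sm sm])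
    show "T (r *\<^sub>R s) = r *\<^sub>R T s" for r s
      using suminf_scaleR_right[OF sm[of s], of r] by (simp add: T_def scaleR_ell1.rep_eq)
  qed
  moreover have "norm (T s) = norm s" for s
  proof -
    have "(\<lambda>n. norm (\<Sum>i<n. ell1_nth s i *\<^sub>R e i)) \<longlonglongrightarrow> norm (T s)"
      unfolding T_def by (intro tendsto_norm summable_LIMSEQ sm)
    moreover have "(\<lambda>n. \<Sum>i<n. \<bar>ell1_nth s i\<bar>) \<longlonglongrightarrow> norm s"
      unfolding norm_ell1.rep_eq by (intro summable_LIMSEQ sa)
    ultimately show ?thesis unfolding assms by (rule LIMSEQ_unique)
  qed
  ultimately show ?thesis by blast
qed

lemma isometry_if_optimal_pairs:
  fixes x y :: "nat \<Rightarrow> 'a::metric_space"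
  assumes "optimal_pairs x y"
  shows "\<exists>T :: ell1 \<Rightarrow> 'a TC. linear T \<and> (\<forall>s. norm (T s) = norm s)"
proof (rule isometry_from_ell1)
  define f where "f i = inverse (dist (x i) (y i)) *\<^sub>R molecule (x i) (y i)" for i
  fix a :: "nat \<Rightarrow> real" and n
  have "norm (\<Sum>i<n. a i *\<^sub>R to_completion (f i)) = norm (to_completion (\<Sum>i<n. a i *\<^sub>R f i))"
    by (simp add: linear_sum[OF linear_to_completion] linear_scale[OF linear_to_completion])
  also have "\<dots> = (\<Sum>i<n. \<bar>a i\<bar>)"
  proof (cases "n = 0")
    case False
    then have "min_weight_perfect_matching (x ` {..<n} \<union> y ` {..<n}) n x y"
      using assms by (simp add: optimal_pairs_def)
    then show ?thesis
      unfolding norm_to_completion f_def by (rule norm_sum_molecules_of_minimal_matching)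
  qed (simp add: norm_to_completion)
  finally show "norm (\<Sum>i<n. a i *\<^sub>R to_completion (f i)) = (\<Sum>i<n. \<bar>a i\<bar>)" .
qed

section \<open>Finite Kantorovich duality\<close>

definition sublinear :: "('b::real_vector \<Rightarrow> real) \<Rightarrow> bool" where
  "sublinear p \<longleftrightarrow> (\<forall>x y. p (x + y) \<le> p x + p y) \<and> (\<forall>x. \<forall>t>0. p (t *\<^sub>R x) = t * p x) \<and> p 0 = 0"

lemma sublinear_neg: "sublinear p \<Longrightarrow> - p (- x) \<le> p x"
  unfolding sublinear_def by (metis add.right_inverse add_le_cancel_left diff_0 diff_le_eq minus_le_iff add.commute)

text \<open>The Hahn-Banach step for one direction: \<open>q x = (INF t\<ge>0. p (x + t *\<^sub>R b) - t * p b)\<close> is a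
  sublinear function below \<open>p\<close> that is linear along \<open>b\<close> and agrees with \<open>p\<close> at \<open>b\<close>. Iterating the
  step settles finitely many directions, which suffices for a finitely supported problem.\<close>

lemma sublinear_symmetrize:
  fixes p :: "'b::real_vector \<Rightarrow> real"
  assumes p: "sublinear p"
  obtains q where "sublinear q" "\<And>x. q x \<le> p x" "q b = p b" "q (- b) = - p b"
proof -
  have add: "p (x + y) \<le> p x + p y" and scale: "0 < t \<Longrightarrow> p (t *\<^sub>R x) = t * p x" and zero: "p 0 = 0"
    for x y t using p by (auto simp: sublinear_def)
  have scale0: "p (t *\<^sub>R x) = t * p x" if "0 \<le> t" for t x
    using scale[of t x] zero that by (cases "t = 0") auto
  define F where "F x t = p (x + t *\<^sub>R b) - t * p b" for x t
  define q where "q x = (INF t\<in>{0..}. F x t)" for x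
  have low: "- p (- x) \<le> F x t" if "0 \<le> t" for x t
    using add[of "x + t *\<^sub>R b" "- x"] scale0[OF that, of b] by (simp add: F_def)
  have bdd: "bdd_below (F x ` {0..})" for x
    by (rule bdd_belowI[of _ "- p (- x)"]) (use low in auto)
  have le: "q x \<le> F x t" if "0 \<le> t" for x t
    unfolding q_def using that by (intro cINF_lower bdd) auto
  have ge: "c \<le> q x" if "\<And>t. 0 \<le> t \<Longrightarrow> c \<le> F x t" for c x
    unfolding q_def using that by (intro cINF_greatest) auto
  have qp: "q x \<le> p x" for x using le[of 0 x] by (simp add: F_def)
  have sub: "q (x + y) \<le> q x + q y" for x y
  proof -
    have *: "q (x + y) \<le> F x t + F y s" if "0 \<le> t" "0 \<le> s" for t s
    proof -
      have "q (x + y) \<le> F (x + y) (t + s)" using that by (intro le) simp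
      also have "\<dots> \<le> F x t + F y s"
        using add[of "x + t *\<^sub>R b" "y + s *\<^sub>R b"] by (simp add: F_def algebra_simps)
      finally show ?thesis .
    qed
    have "q (x + y) - F x t \<le> q y" if "0 \<le> t" for t
      using *[OF that] by (intro ge) (simp add: algebra_simps)
    then have "q (x + y) - q y \<le> q x" by (intro ge) (simp add: algebra_simps)
    then show ?thesis by simp
  qed
  have scale_le: "q (r *\<^sub>R x) \<le> r * q x" if "0 < r" for r x
  proof -
    have "q (r *\<^sub>R x) / r \<le> q x"
    proof (rule ge)
      fix t :: real assume "0 \<le> t"
      have "q (r *\<^sub>R x) \<le> F (r *\<^sub>R x) (r * t)" using \<open>0 \<le> t\<close> that by (intro le) simp
      also have "\<dots> = r * F x t"
        using scale[OF that, of "x + t *\<^sub>R b"] by (simp add: F_def algebra_simps)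
      finally show "q (r *\<^sub>R x) / r \<le> F x t" using that by (simp add: divide_le_eq mult.commute)
    qed
    then show ?thesis using that by (simp add: divide_le_eq mult.commute)
  qed
  have scaleq: "q (r *\<^sub>R x) = r * q x" if "0 < r" for r x
  proof (rule antisym[OF scale_le[OF that]])
    have "q (inverse r *\<^sub>R (r *\<^sub>R x)) \<le> inverse r * q (r *\<^sub>R x)"
      using that by (intro scale_le) simp
    then show "r * q x \<le> q (r *\<^sub>R x)" using that by (simp add: field_simps)
  qed
  have "q 0 = 0" using ge[of 0 0] low[of _ 0] qp[of 0] zero by fastforce
  then have q: "sublinear q" using sub scaleq by (simp add: sublinear_def)
  have "p b \<le> q b"
  proof (rule ge)
    fix t :: real assume "0 \<le> t"
    then show "p b \<le> F b t" using scale[of "1 + t" b] by (simp add: F_def algebra_simps)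
  qed
  then have qb: "q b = p b" using qp[of b] by linarith
  have "q (- b) \<le> - p b" using le[of 1 "- b"] zero by (simp add: F_def)
  moreover have "- q (- b) \<le> q b" using sublinear_neg[OF q] .
  ultimately have "q (- b) = - p b" using qb by linarith
  then show ?thesis using that q qp qb by blast
qed

text \<open>Symmetry at a vector persists when a sublinear function is replaced by a smaller one, because
  \<open>- q (- x) \<le> q x\<close>.\<close>

lemma sublinear_symmetric_on:
  assumes "finite B" "sublinear p"
  obtains q where "sublinear q" "\<And>x. q x \<le> p x" "\<And>b. b \<in> B \<Longrightarrow> q (- b) = - q b"
  using assms
proof (induction B arbitrary: thesis)
  case (insert b B)
  obtain q where q: "sublinear q" "\<And>x. q x \<le> p x" "\<And>c. c \<in> B \<Longrightarrow> q (- c) = - q c"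
    using insert by blast
  obtain r where r: "sublinear r" "\<And>x. r x \<le> q x" "r (- b) = - r b"
    using sublinear_symmetrize[OF q(1), of b] by metis
  have "r (- c) = - r c" if "c \<in> B" for c
    using r(2)[of c] r(2)[of "- c"] sublinear_neg[OF r(1), of c] q(3)[OF that] by linarith
  moreover have "r x \<le> p x" for x using r(2) q(2) by (rule order_trans)
  ultimately show ?case using r by (intro insert.prems(1)[of r]) auto
qed blast

lemma sublinear_sum:
  assumes p: "sublinear p" and "finite I" "\<And>i. i \<in> I \<Longrightarrow> p (- b i) = - p (b i)"
  shows "p (\<Sum>i\<in>I. a i *\<^sub>R b i) \<le> (\<Sum>i\<in>I. a i * p (b i))"
  using assms(2,3)
proof (induction I)
  case empty
  then show ?case using p by (simp add: sublinear_def)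
next
  case (insert i I)
  have "p (a i *\<^sub>R b i) = a i * p (b i)"
  proof (cases "a i" "0::real" rule: linorder_cases)
    case less
    then have "p ((- a i) *\<^sub>R (- b i)) = - a i * p (- b i)"
      using p unfolding sublinear_def by (meson neg_0_less_iff_less)
    then show ?thesis using insert.prems[of i] by simp
  qed (use p in \<open>auto simp: sublinear_def\<close>)
  moreover have "p (a i *\<^sub>R b i + (\<Sum>i\<in>I. a i *\<^sub>R b i)) \<le> p (a i *\<^sub>R b i) + p (\<Sum>i\<in>I. a i *\<^sub>R b i)"
    using p unfolding sublinear_def by blast
  ultimately show ?case using insert by fastforce
qed

lemma TP_eq_sum_molecules:
  "h = (\<Sum>v | TP_fun h v \<noteq> 0. TP_fun h v *\<^sub>R molecule v w)"
proof -
  have fun_sum: "TP_fun (\<Sum>v\<in>S. F v) z = (\<Sum>v\<in>S. TP_fun (F v) z)" for S and F :: "'a \<Rightarrow> 'a TP" and z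
    by (induction S rule: infinite_finite_induct) (auto simp: zero_TP.rep_eq plus_TP.rep_eq)
  have "TP_fun (\<Sum>v | TP_fun h v \<noteq> 0. TP_fun h v *\<^sub>R molecule v w) z = TP_fun h z" for z
  proof -
    have "TP_fun (\<Sum>v | TP_fun h v \<noteq> 0. TP_fun h v *\<^sub>R molecule v w) z
        = (\<Sum>v | TP_fun h v \<noteq> 0. TP_fun h v * indicator {v} z)
          - (\<Sum>v | TP_fun h v \<noteq> 0. TP_fun h v) * indicator {w} z"
      by (simp add: fun_sum scaleR_TP.rep_eq molecule.rep_eq right_diff_distrib sum_subtractf
          sum_distrib_right)
    also have "\<dots> = (\<Sum>v | TP_fun h v \<noteq> 0. if z = v then TP_fun h v else 0)"
      unfolding sum_TP_fun by (auto simp: indicator_def intro!: sum.cong)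
    also have "\<dots> = TP_fun h z" using finite_TP_fun[of h] by simp
    finally show ?thesis .
  qed
  then have "TP_fun (\<Sum>v | TP_fun h v \<noteq> 0. TP_fun h v *\<^sub>R molecule v w) = TP_fun h" by (rule ext)
  then show ?thesis by (simp only: TP_fun_inject)
qed

text \<open>Kantorovich duality. Symmetrize the norm first at \<open>h\<close> and then at the molecules \<open>molecule v w\<close> for
  \<open>v\<close> in the support of \<open>h\<close> and a fixed base point \<open>w\<close>. The values at these molecules are a 1-Lipschitz function on the
  support that norms \<open>h\<close>; it is extended to the whole space and truncated, which provides the bound \<open>D\<close>.\<close>

lemma norming_function:
  fixes h :: "'a::metric_space TP"
 obtains g D where "lip1 g" "pairing g h = norm h" "\<And>v. \<bar>g v\<bar> \<le> D"
proof (cases "h = 0")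
  case True
  show ?thesis
    by (rule that[of "\<lambda>_. 0" 0]) (use True linear_0[OF linear_pairing] in auto)
next
  case False
  define S where "S = {v. TP_fun h v \<noteq> 0}"
  have fin: "finite S" by (simp add: S_def finite_TP_fun)
  have "S \<noteq> {}"
  proof
    assume "S = {}"
    then have "TP_fun h = TP_fun 0" by (auto simp: S_def zero_TP.rep_eq)
    then show False using False by (simp add: TP_fun_inject)
  qed
  then obtain w where w: "w \<in> S" by blast
  have "sublinear (norm :: 'a TP \<Rightarrow> real)"
    by (auto simp: sublinear_def norm_triangle_ineq)
  then obtain p where p: "sublinear p" "\<And>x. p x \<le> norm x" "p (- h) = - norm h"
    using sublinear_symmetrize[of norm h] by metis
  obtain q where q: "sublinear q" "\<And>x. q x \<le> p x"
    "\<And>b. b \<in> (\<lambda>v. molecule v w) ` S \<Longrightarrow> q (- b) = - q b"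
    using sublinear_symmetric_on[of "(\<lambda>v. molecule v w) ` S" p] fin p(1) by blast
  define c where "c v = q (molecule v w)" for v
  have c: "c u \<le> c v + dist u v" if "u \<in> S" "v \<in> S" for u v
  proof -
    have "molecule u w = molecule u v + molecule v w"
      by transfer (auto simp: fun_eq_iff)
    then have "c u \<le> q (molecule u v) + c v"
      using q(1) by (simp add: sublinear_def c_def)
    moreover have "q (molecule u v) \<le> dist u v"
      using q(2) p(2) norm_molecule_le by (meson order_trans)
    ultimately show ?thesis by simp
  qed
  define m where "m v = Min ((\<lambda>s. c s + dist v s) ` S)" for v
  define g where "g v = min (Max (c ` S)) (m v)" for v
  have "lip1 m" unfolding m_def using fin \<open>S \<noteq> {}\<close> by (rule lip1_Min)
  have gS: "g v = c v" if "v \<in> S" for v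
  proof -
    have "m v \<le> c v + dist v v" unfolding m_def using fin that by (intro Min_le image_eqI[of _ _ v]) auto
    moreover have "c v \<le> m v"
      unfolding m_def using fin that c[OF that] by (subst Min_ge_iff) auto
    moreover have "c v \<le> Max (c ` S)" using fin that by simp
    ultimately show ?thesis by (simp add: g_def)
  qed
  have gl: "lip1 g"
  proof (intro allI)
    fix u v
    have "m u - m v \<le> dist u v" using \<open>lip1 m\<close> by blast
    then show "g u - g v \<le> dist u v" unfolding g_def min_def using zero_le_dist[of u v] by (auto simp del: zero_le_dist)
  qed
  \<comment> \<open>Passing from \<open>p\<close> to \<open>q\<close> keeps the value at \<open>h\<close>, as \<open>p\<close> is symmetric there.\<close>
  have "norm h \<le> q h" using sublinear_neg[OF q(1), of h] q(2)[of "- h"] p(3) by linarith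
  also have "\<dots> = q (\<Sum>v\<in>S. TP_fun h v *\<^sub>R molecule v w)"
    unfolding S_def by (subst TP_eq_sum_molecules[of h w]) simp
  also have "\<dots> \<le> (\<Sum>v\<in>S. TP_fun h v * c v)"
    unfolding c_def using q(3) by (intro sublinear_sum q(1) fin) auto
  also have "\<dots> = pairing g h" by (simp add: pairing_def S_def[symmetric] gS)
  finally have "pairing g h = norm h" using pairing_le_norm[OF gl, of h] by simp
  moreover have "\<bar>g v\<bar> \<le> max \<bar>Max (c ` S)\<bar> \<bar>Min (c ` S)\<bar>" for v
  proof -
    have "Min (c ` S) \<le> m v"
      unfolding m_def
    proof (subst Min_ge_iff)
      show "\<forall>a\<in>(\<lambda>s. c s + dist v s) ` S. Min (c ` S) \<le> a"
        using fin by (auto intro!: add_increasing2)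
    qed (use fin \<open>S \<noteq> {}\<close> in auto)
    moreover have "Min (c ` S) \<le> Max (c ` S)" using fin w by (meson Max_ge Min_le image_eqI order_trans finite_imageI)
    ultimately show ?thesis unfolding g_def by linarith
  qed
  ultimately show ?thesis using that gl by blast
qed

section \<open>Tight pairs in uniformly discrete spaces\<close>

text \<open>The negative mass of \<open>h\<close> outside \<open>K\<close> is at most half of the mass at \<open>u\<close>. If \<open>u\<close> had no almost tight
  partner in \<open>K\<close>, then \<open>g\<close> could be raised by \<open>\<eta>\<close> at \<open>u\<close> while staying unchanged at the negative points in \<open>K\<close>:
  raise it by \<open>\<eta>\<close> off \<open>K\<close> and take the largest 1-Lipschitz function below these values on the
  negative points and \<open>K\<close>. The gain at \<open>u\<close> is at least \<open>a * \<eta>\<close>, the loss at negative points off \<open>K\<close> is at most \<open>a * \<eta> / 2\<close>, and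
  points of nonnegative mass lose nothing, because \<open>g\<close> never decreases. For \<open>\<theta> < a * \<eta> / 2\<close> this exceeds
  what a nearly norming function can gain.\<close>

lemma tight_partner_of_nearly_norming:
  fixes h :: "'a::metric_space TP"
  assumes u: "a \<le> TP_fun h u" "0 < a" and K: "finite K" "u \<notin> K"
    and tail: "(\<Sum>v | TP_fun h v < 0 \<and> v \<notin> K. - TP_fun h v) \<le> a / 2"
    and g: "lip1 g" "norm h - \<theta> \<le> pairing g h" and \<theta>: "\<theta> < a * \<eta> / 2" and "0 < \<eta>"
  shows "\<exists>v\<in>K. dist u v - (g u - g v) < \<eta>"
proof (rule ccontr)
  assume "\<not> ?thesis"
  then have slack: "g u + \<eta> \<le> g v + dist u v" if "v \<in> K" for v using that by force
  let ?S = "{v. TP_fun h v \<noteq> 0}"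
  define N where "N = {v. TP_fun h v < 0} \<union> K"
  have finN: "finite N"
    unfolding N_def using K by (auto intro: finite_subset[OF _ finite_TP_fun[of h]])
  have "N \<noteq> {}"
  proof
    assume "N = {}"
    then have "0 \<le> TP_fun h v" for v by (auto simp: N_def not_less[symmetric])
    then have "TP_fun h u = 0"
      using sum_nonneg_eq_0_iff[OF finite_TP_fun[of h], of "TP_fun h"] sum_TP_fun[of h] by auto
    then show False using u by simp
  qed
  define c where "c v = (if v \<in> K then g v else g v + \<eta>)" for v
  define g' where "g' v = Min ((\<lambda>s. c s + dist v s) ` N)" for v
  have "lip1 g'" unfolding g'_def using finN \<open>N \<noteq> {}\<close> by (rule lip1_Min)
  then have up: "pairing g' h \<le> norm h" by (rule pairing_le_norm)
  have g'_ge: "b \<le> g' v" if "\<And>s. s \<in> N \<Longrightarrow> b \<le> c s + dist v s" for b v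
    unfolding g'_def using finN \<open>N \<noteq> {}\<close> that by (subst Min_ge_iff) auto
  have "g v \<le> c s + dist v s" for v s
  proof -
    have "g v - g s \<le> dist v s" using g(1) by blast
    then show ?thesis using \<open>0 < \<eta>\<close> by (simp add: c_def)
  qed
  then have gg': "g v \<le> g' v" for v by (intro g'_ge)
  have g'c: "g' v \<le> c v" if "v \<in> N" for v
  proof -
    have "g' v \<le> c v + dist v v" unfolding g'_def using finN that by (intro Min_le image_eqI[of _ _ v]) auto
    then show ?thesis by simp
  qed
  have g'u: "g u + \<eta> \<le> g' u"
  proof (rule g'_ge)
    fix s assume "s \<in> N"
    show "g u + \<eta> \<le> c s + dist u s"
    proof (cases "s \<in> K")
      case False
      have "g u - g s \<le> dist u s" using g(1) by blast
      then show ?thesis using False by (simp add: c_def)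
    qed (use slack in \<open>simp add: c_def\<close>)
  qed
  define G where "G v = TP_fun h v * (g' v - g v)" for v
  define B where "B = {v. TP_fun h v < 0 \<and> v \<notin> K}"
  have finB: "finite B" unfolding B_def by (rule finite_subset[OF _ finite_TP_fun[of h]]) auto
  have "u \<in> ?S" "u \<notin> B" "B \<subseteq> ?S" using u by (auto simp: B_def)
  have G0: "0 \<le> G v" if "v \<notin> B" for v
  proof (cases "TP_fun h v < 0")
    case True
    then have "g' v \<le> g v" using g'c[of v] that by (auto simp: N_def B_def c_def)
    then show ?thesis using True by (simp add: G_def mult_nonpos_nonpos)
  qed (use gg'[of v] in \<open>simp add: G_def\<close>)
  have "a * \<eta> \<le> G u"
    unfolding G_def using u g'u \<open>0 < \<eta>\<close> by (intro mult_mono) auto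
  moreover have "- (a * \<eta> / 2) \<le> sum G B"
  proof -
    have "\<eta> * TP_fun h v \<le> G v" if "v \<in> B" for v
    proof -
      have "g' v - g v \<le> \<eta>" using g'c[of v] that by (auto simp: N_def B_def c_def)
      moreover have "TP_fun h v \<le> 0" using that by (simp add: B_def)
      ultimately show ?thesis unfolding G_def using mult_left_mono_neg by (metis mult.commute)
    qed
    then have "\<eta> * sum (TP_fun h) B \<le> sum G B" unfolding sum_distrib_left by (rule sum_mono)
    moreover have "- (a / 2) \<le> sum (TP_fun h) B"
      using tail unfolding B_def[symmetric] by (simp add: sum_negf)
    then have "\<eta> * - (a / 2) \<le> \<eta> * sum (TP_fun h) B" using \<open>0 < \<eta>\<close> by (intro mult_left_mono) auto
    ultimately show ?thesis by (simp add: mult.commute)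
  qed
  moreover have "G u + sum G B \<le> sum G ?S"
  proof -
    have "G u + sum G B = sum G (insert u B)" using finB \<open>u \<notin> B\<close> by simp
    also have "\<dots> \<le> sum G ?S"
      using finite_TP_fun[of h] \<open>u \<in> ?S\<close> \<open>B \<subseteq> ?S\<close> G0 by (intro sum_mono2) auto
    finally show ?thesis .
  qed
  moreover have "sum G ?S = pairing g' h - pairing g h"
    by (simp add: G_def pairing_def sum_subtractf right_diff_distrib)
  ultimately have "a * \<eta> / 2 \<le> pairing g' h - pairing g h" by linarith
  then show False using up g(2) \<theta> by linarith
qed

lemma pairing_restrict:
  assumes "finite S"
  shows "pairing (\<lambda>v. if v \<in> S then g v else 0) h = (\<Sum>v\<in>S. TP_fun h v * g v)"
proof -
  let ?U = "S \<union> {v. TP_fun h v \<noteq> 0}"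
  have "pairing (\<lambda>v. if v \<in> S then g v else 0) h = (\<Sum>v\<in>?U. TP_fun h v * (if v \<in> S then g v else 0))"
    using assms finite_TP_fun[of h] by (intro pairing_superset) auto
  also have "\<dots> = (\<Sum>v\<in>S. TP_fun h v * g v)"
    using assms finite_TP_fun[of h] by (intro sum.mono_neutral_cong_right) auto
  finally show ?thesis .
qed

text \<open>In a uniformly discrete space every bounded function is Lipschitz, so the transportation cost
  norm dominates a multiple of the \<open>l1\<close> norm.\<close>

lemma abs_pairing_le_if_bounded:
  fixes h :: "'a::metric_space TP"
  assumes "0 < \<delta>" "\<And>u v :: 'a. u \<noteq> v \<Longrightarrow> \<delta> \<le> dist u v" "0 < D" "\<And>v. \<bar>f v\<bar> \<le> D"
  shows "\<bar>pairing f h\<bar> \<le> 2 * D / \<delta> * norm h"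
proof -
  define c where "c = \<delta> / (2 * D)"
  have c: "0 < c" using assms by (simp add: c_def)
  have "lip1 (\<lambda>v. c * f v)"
  proof (intro allI)
    fix u v
    show "c * f u - c * f v \<le> dist u v"
    proof (cases "u = v")
      case False
      have "f u - f v \<le> 2 * D" using assms(4)[of u] assms(4)[of v] by linarith
      then have "c * (f u - f v) \<le> c * (2 * D)" using c by (intro mult_left_mono) auto
      also have "\<dots> = \<delta>" using assms(3) by (simp add: c_def)
      finally show ?thesis using assms(2)[OF False] by (simp add: right_diff_distrib)
    qed simp
  qed
  then have "\<bar>c * pairing f h\<bar> \<le> norm h"
    using abs_pairing_le_norm[of "\<lambda>v. c * f v" h] by (simp add: pairing_cmult_left)
  then have "\<bar>pairing f h\<bar> \<le> norm h / c" using c by (simp add: abs_mult le_divide_eq mult.commute)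
  also have "norm h / c = 2 * D / \<delta> * norm h" by (simp add: c_def)
  finally show ?thesis .
qed

lemma TP_fun_eq_pairing: "TP_fun h u = pairing (\<lambda>v. if v \<in> {u} then 1 else 0) h"
  using pairing_restrict[of "{u}" "\<lambda>_. 1" h] by simp

text \<open>In \<open>near_norming\<close> and \<open>tight\<close> the sequence \<open>h\<close> stands for the element of the completion that it
  represents. A pair is tight if all functions that norm this element up to \<open>\<theta>\<close> have almost
  maximal slope from \<open>u\<close> to \<open>v\<close>, the error tending to 0 with \<open>\<theta>\<close>.\<close>

definition near_norming :: "real \<Rightarrow> (nat \<Rightarrow> 'a::metric_space TP) \<Rightarrow> ('a \<Rightarrow> real) set" where
  "near_norming \<theta> h = {g. lip1 g \<and> (\<forall>\<^sub>F n in sequentially. norm (h n) - \<theta> \<le> pairing g (h n))}"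

definition tight :: "(nat \<Rightarrow> 'a::metric_space TP) \<Rightarrow> 'a \<Rightarrow> 'a \<Rightarrow> bool" where
  "tight h u v \<longleftrightarrow> (\<forall>\<eta>>0. \<exists>\<theta>>0. \<forall>g\<in>near_norming \<theta> h. dist u v - (g u - g v) \<le> \<eta>)"

text \<open>The mass at \<open>u\<close> is eventually more than \<open>a\<close>, and the support of a late \<open>h N\<close> serves as the finite
  set \<open>K\<close>, so that each nearly norming function has an almost tight partner of \<open>u\<close> in \<open>K\<close>, a priori
  depending on the function. If no point of \<open>K\<close> served all nearly norming functions, take for each
  point a function that is not almost tight there. Their average is still nearly norming, and it is not
  almost tight at any point of \<open>K\<close>: its slack is the average of the nonnegative slacks.\<close>

lemma tight_pair_at_positive_coordinate:
  fixes h :: "nat \<Rightarrow> 'a::metric_space TP"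
  assumes disc: "0 < \<delta>" "\<And>u v :: 'a. u \<noteq> v \<Longrightarrow> \<delta> \<le> dist u v"
    and "Cauchy h" and lim: "(\<lambda>n. TP_fun (h n) u) \<longlonglongrightarrow> l" "0 < l"
  shows "\<exists>v. u \<noteq> v \<and> tight h u v"
proof -
  define a where "a = l / 2"
  have a: "0 < a" "a < l" using lim(2) by (auto simp: a_def)
  obtain N1 where N1: "\<And>n. n \<ge> N1 \<Longrightarrow> a < TP_fun (h n) u"
    using order_tendstoD(1)[OF lim(1) a(2)] by (auto simp: eventually_sequentially)
  have "0 < a * \<delta> / 4" using a disc by simp
  then obtain N2 where N2: "\<And>m n. m \<ge> N2 \<Longrightarrow> n \<ge> N2 \<Longrightarrow> norm (h m - h n) < a * \<delta> / 4"
    using CauchyD[OF assms(3)] by blast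
  define N where "N = max N1 N2"
  define K where "K = {v. TP_fun (h N) v \<noteq> 0} - {u}"
  have K: "finite K" "u \<notin> K" by (auto simp: K_def finite_TP_fun)
  have tail: "(\<Sum>v | TP_fun (h n) v < 0 \<and> v \<notin> K. - TP_fun (h n) v) \<le> a / 2" if n: "n \<ge> N" for n
  proof -
    define A where "A = {v. TP_fun (h n) v < 0 \<and> v \<notin> K}"
    have fin: "finite A" unfolding A_def by (rule finite_subset[OF _ finite_TP_fun[of "h n"]]) auto
    have "TP_fun (h n) u > 0" using N1[of n] a n by (simp add: N_def)
    then have z: "TP_fun (h N) v = 0" if "v \<in> A" for v using that by (auto simp: A_def K_def)
    let ?f = "\<lambda>v. if v \<in> A then - 1 else 0 :: real"
    have "(\<Sum>v\<in>A. - TP_fun (h n) v) = pairing ?f (h n)"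
      unfolding pairing_restrict[OF fin] by simp
    also have "\<dots> = pairing ?f (h n - h N)"
      unfolding pairing_restrict[OF fin] using z by (intro sum.cong) (auto simp: minus_TP.rep_eq)
    also have "\<dots> \<le> \<bar>pairing ?f (h n - h N)\<bar>" by (rule abs_ge_self)
    also have "\<dots> \<le> 2 * 1 / \<delta> * norm (h n - h N)"
      by (rule abs_pairing_le_if_bounded[OF disc]) auto
    also have "\<dots> \<le> 2 * 1 / \<delta> * (a * \<delta> / 4)"
      using N2[of n N] n disc(1) by (intro mult_left_mono) (auto simp: N_def)
    also have "\<dots> = a / 2" using disc(1) by simp
    finally show ?thesis by (simp add: A_def)
  qed
  have slack: "\<exists>v\<in>K. dist u v - (g u - g v) < \<eta>"
    if "n \<ge> N" "lip1 g" "norm (h n) - \<theta> \<le> pairing g (h n)" "\<theta> < a * \<eta> / 2" "0 < \<eta>" for n g \<theta> \<eta>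
    using that N1[of n] a K tail[of n]
    by (intro tight_partner_of_nearly_norming[of a "h n" u K g \<theta> \<eta>]) (auto simp: N_def)
  have "\<exists>v\<in>K. tight h u v"
  proof (rule ccontr)
    assume none: "\<not> ?thesis"
    have "\<forall>v\<in>K. \<exists>\<eta>>0. \<forall>\<theta>>0. \<exists>g\<in>near_norming \<theta> h. \<eta> < dist u v - (g u - g v)"
      using none by (simp add: tight_def not_le)
    then obtain e where e: "\<And>v. v \<in> K \<Longrightarrow> 0 < e v"
      "\<And>v \<theta>. v \<in> K \<Longrightarrow> 0 < \<theta> \<Longrightarrow> \<exists>g\<in>near_norming \<theta> h. e v < dist u v - (g u - g v)"
      by metis
    have "K \<noteq> {}"
    proof -
      obtain g D where "lip1 g" "pairing g (h N) = norm (h N)" "\<And>v. \<bar>g v\<bar> \<le> D"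
        using norming_function[of "h N"] by blast
      then show ?thesis using slack[of N g 0 1] a by auto
    qed
    define k where "k = real (card K)"
    have k: "0 < k" using K(1) \<open>K \<noteq> {}\<close> by (simp add: k_def card_gt_0_iff)
    define \<eta> where "\<eta> = Min (e ` K) / k"
    have "0 < Min (e ` K)" using K(1) \<open>K \<noteq> {}\<close> e(1) by (subst Min_gr_iff) auto
    then have \<eta>: "0 < \<eta>" using k by (simp add: \<eta>_def)
    define \<theta> where "\<theta> = a * \<eta> / 4"
    have \<theta>: "0 < \<theta>" "\<theta> < a * \<eta> / 2" using a \<eta> by (auto simp: \<theta>_def)
    have "\<forall>v\<in>K. \<exists>g\<in>near_norming \<theta> h. e v < dist u v - (g u - g v)" using e(2)[OF _ \<theta>(1)] by blast
    then obtain G where "\<forall>v\<in>K. G v \<in> near_norming \<theta> h \<and> e v < dist u v - (G v u - G v v)" by metis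
    then have G: "\<And>v. v \<in> K \<Longrightarrow> lip1 (G v)"
      "\<And>v. v \<in> K \<Longrightarrow> \<forall>\<^sub>F n in sequentially. norm (h n) - \<theta> \<le> pairing (G v) (h n)"
      "\<And>v. v \<in> K \<Longrightarrow> e v < dist u v - (G v u - G v v)"
      by (auto simp: near_norming_def)
    define g where "g w = inverse k * (\<Sum>v\<in>K. G v w)" for w
    have gslack: "dist x y - (g x - g y) = inverse k * (\<Sum>v\<in>K. dist x y - (G v x - G v y))" for x y
      using k by (simp add: g_def sum_subtractf k_def right_diff_distrib)
    have "lip1 g"
    proof (intro allI)
      fix x y
      have "0 \<le> inverse k * (\<Sum>v\<in>K. dist x y - (G v x - G v y))"
        using G(1) k by (intro mult_nonneg_nonneg sum_nonneg) auto
      then show "g x - g y \<le> dist x y" using gslack[of x y] by simp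
    qed
    have "\<forall>\<^sub>F n in sequentially. (\<forall>v\<in>K. norm (h n) - \<theta> \<le> pairing (G v) (h n)) \<and> N \<le> n"
      using G(2) K(1) by (intro eventually_conj eventually_ball_finite eventually_ge_at_top) auto
    then obtain n where n: "\<And>v. v \<in> K \<Longrightarrow> norm (h n) - \<theta> \<le> pairing (G v) (h n)" "N \<le> n"
      using eventually_happens'[OF sequentially_bot] by blast
    have "k * (norm (h n) - \<theta>) \<le> (\<Sum>v\<in>K. pairing (G v) (h n))"
      using sum_mono[OF n(1), of K] by (simp add: k_def)
    then have "norm (h n) - \<theta> \<le> inverse k * (\<Sum>v\<in>K. pairing (G v) (h n))"
      using k by (simp add: field_simps)
    also have "\<dots> = pairing g (h n)"
      unfolding g_def by (simp add: pairing_cmult_left pairing_sum_left)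
    finally obtain v where v: "v \<in> K" "dist u v - (g u - g v) < \<eta>"
      using slack[OF n(2) \<open>lip1 g\<close> _ \<theta>(2) \<eta>] by blast
    have "Min (e ` K) \<le> e v" using K(1) v(1) by simp
    also have "\<dots> \<le> dist u v - (G v u - G v v)" using G(3)[OF v(1)] by simp
    also have "\<dots> \<le> (\<Sum>w\<in>K. dist u v - (G w u - G w v))"
      using G(1) K(1) v(1) by (intro member_le_sum) auto
    finally have "\<eta> \<le> dist u v - (g u - g v)"
      unfolding gslack \<eta>_def using k by (simp add: divide_inverse mult.commute)
    then show False using v(2) by simp
  qed
  then show ?thesis using K(2) by metis
qed

text \<open>An element of the completion whose coordinates all vanish is 0. Test with a bounded function \<open>g\<close> that norms a
  late \<open>h N\<close>: off the finite support of an even later \<open>h N'\<close> its contribution is small because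
  the \<open>l1\<close> norm is controlled, and on this support it tends to 0 coordinatewise. The boundedness of \<open>g\<close> is
  essential here, since first moments are not controlled by the norm.\<close>

lemma nonzero_coordinate:
  fixes h :: "nat \<Rightarrow> 'a::metric_space TP"
  assumes disc: "0 < \<delta>" "\<And>u v :: 'a. u \<noteq> v \<Longrightarrow> \<delta> \<le> dist u v"
    and "Cauchy h" and L: "(\<lambda>n. norm (h n)) \<longlonglongrightarrow> L" "0 < L"
  shows "\<exists>u. \<not> (\<lambda>n. TP_fun (h n) u) \<longlonglongrightarrow> 0"
proof (rule ccontr)
  assume "\<not> ?thesis"
  then have null: "(\<lambda>n. TP_fun (h n) u) \<longlonglongrightarrow> 0" for u by blast
  obtain N1 where N1: "\<And>n. n \<ge> N1 \<Longrightarrow> 3 / 4 * L < norm (h n)"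
    using order_tendstoD(1)[OF L(1), of "3 / 4 * L"] L(2) by (auto simp: eventually_sequentially)
  obtain N2 where N2: "\<And>m n. m \<ge> N2 \<Longrightarrow> n \<ge> N2 \<Longrightarrow> norm (h m - h n) < L / 4"
    using CauchyD[OF assms(3), of "L / 4"] L(2) by auto
  define N where "N = max N1 N2"
  obtain g D' where g: "lip1 g" "pairing g (h N) = norm (h N)" and D': "\<And>v. \<bar>g v\<bar> \<le> D'"
    using norming_function[of "h N"] by blast
  define D where "D = D' + 1"
  have D: "0 < D" "\<bar>g v\<bar> \<le> D" for v using D'[of undefined] D'[of v] by (auto simp: D_def)
  have low: "L / 2 \<le> pairing g (h m)" if "m \<ge> N" for m
  proof -
    have "pairing g (h N) - pairing g (h m) \<le> norm (h N - h m)"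
      using pairing_le_norm[OF g(1), of "h N - h m"] by (simp add: linear_diff[OF linear_pairing])
    then show ?thesis using g(2) N1[of N] N2[of N m] that by (simp add: N_def)
  qed
  have "0 < L * \<delta> / (8 * D)" using L(2) disc(1) D(1) by simp
  then obtain N3 where N3: "\<And>m n. m \<ge> N3 \<Longrightarrow> n \<ge> N3 \<Longrightarrow> norm (h m - h n) < L * \<delta> / (8 * D)"
    using CauchyD[OF assms(3)] by blast
  define N' where "N' = max N N3"
  define S where "S = {v. TP_fun (h N') v \<noteq> 0}"
  have fin: "finite S" by (simp add: S_def finite_TP_fun)
  have "L / 4 \<le> (\<Sum>v\<in>S. TP_fun (h m) v * g v)" if "m \<ge> N'" for m
  proof -
    let ?f = "\<lambda>v. if v \<in> S then 0 else g v"
    let ?r = "\<lambda>v. if v \<in> S then g v else 0"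
    have "pairing ?f (h N') = 0" unfolding pairing_def by (auto simp: S_def intro!: sum.neutral)
    then have "\<bar>pairing ?f (h m)\<bar> = \<bar>pairing ?f (h m - h N')\<bar>"
      by (simp add: linear_diff[OF linear_pairing])
    also have "\<dots> \<le> 2 * D / \<delta> * norm (h m - h N')"
      using D by (intro abs_pairing_le_if_bounded disc) (auto intro: less_imp_le)
    also have "\<dots> \<le> 2 * D / \<delta> * (L * \<delta> / (8 * D))"
      using N3[of m N'] that disc(1) D(1) by (intro mult_left_mono) (auto simp: N'_def)
    also have "\<dots> = L / 4" using disc(1) D(1) by simp
    finally have "pairing ?f (h m) \<le> L / 4" by simp
    moreover have "pairing g (h m) = pairing (\<lambda>v. ?f v + ?r v) (h m)"
      by (rule arg_cong[where f = "\<lambda>g. pairing g (h m)"]) auto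
    then have "pairing g (h m) = pairing ?f (h m) + (\<Sum>v\<in>S. TP_fun (h m) v * g v)"
      by (simp only: pairing_add_left pairing_restrict[OF fin])
    ultimately show ?thesis using low[of m] that by (simp add: N'_def)
  qed
  moreover have "(\<lambda>m. \<Sum>v\<in>S. TP_fun (h m) v * g v) \<longlonglongrightarrow> (\<Sum>v\<in>S. 0 * g v)"
    by (intro tendsto_intros null)
  ultimately have "L / 4 \<le> (\<Sum>v\<in>S. 0 * g v)" by (intro LIMSEQ_le_const) auto
  then show False using L(2) by simp
qed

lemma tight_pair:
  fixes h :: "nat \<Rightarrow> 'a::metric_space TP"
  assumes disc: "0 < \<delta>" "\<And>u v :: 'a. u \<noteq> v \<Longrightarrow> \<delta> \<le> dist u v"
    and h: "Cauchy h" and L: "(\<lambda>n. norm (h n)) \<longlonglongrightarrow> L" "0 < L"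
  shows "\<exists>u v. u \<noteq> v \<and> tight h u v"
proof -
  obtain u where u: "\<not> (\<lambda>n. TP_fun (h n) u) \<longlonglongrightarrow> 0" using nonzero_coordinate[OF assms] by blast
  have "Cauchy (\<lambda>n. TP_fun (h n) u)"
  proof (rule CauchyI)
    fix e :: real assume "0 < e"
    then have "0 < e * \<delta> / 2" using disc(1) by simp
    then obtain N where N: "\<And>m n. m \<ge> N \<Longrightarrow> n \<ge> N \<Longrightarrow> norm (h m - h n) < e * \<delta> / 2"
      using CauchyD[OF h] by blast
    have "norm (TP_fun (h m) u - TP_fun (h n) u) < e" if "m \<ge> N" "n \<ge> N" for m n
    proof -
      have "\<bar>TP_fun (h m - h n) u\<bar> \<le> 2 * 1 / \<delta> * norm (h m - h n)"
        unfolding TP_fun_eq_pairing by (rule abs_pairing_le_if_bounded[OF disc]) auto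
      also have "\<dots> < 2 * 1 / \<delta> * (e * \<delta> / 2)"
        using N[OF that] disc(1) by (intro mult_strict_left_mono) auto
      also have "\<dots> = e" using disc(1) by simp
      finally show ?thesis by (simp add: minus_TP.rep_eq)
    qed
    then show "\<exists>M. \<forall>m\<ge>M. \<forall>n\<ge>M. norm (TP_fun (h m) u - TP_fun (h n) u) < e" by blast
  qed
  then obtain l where l: "(\<lambda>n. TP_fun (h n) u) \<longlonglongrightarrow> l"
    by (auto simp: Cauchy_convergent_iff convergent_def)
  \<comment> \<open>A point of negative mass is treated through \<open>- h\<close>, which reverses the pair.\<close>
  consider "0 < l" | "0 < - l" using u l by (cases l "0::real" rule: linorder_cases) auto
  then show ?thesis
  proof cases
    case 1
    then show ?thesis using tight_pair_at_positive_coordinate[OF disc h l] by blast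
  next
    case 2
    have lm: "(\<lambda>n. TP_fun (- h n) u) \<longlonglongrightarrow> - l"
      using tendsto_minus[OF l] by (simp add: uminus_TP.rep_eq)
    have "Cauchy (\<lambda>n. - h n)" by (rule Cauchy_minus_nv[OF h])
    from tight_pair_at_positive_coordinate[OF disc this lm 2]
    obtain v where v: "u \<noteq> v" "tight (\<lambda>n. - h n) u v" by blast
    have "(\<lambda>v. - 1 * g v) \<in> near_norming \<theta> (\<lambda>n. - h n)" if g: "g \<in> near_norming \<theta> h" for g \<theta>
    proof -
      have "- 1 * g x - - 1 * g y \<le> dist x y" for x y
      proof -
        have "g y - g x \<le> dist y x" using g by (simp add: near_norming_def)
        then show ?thesis by (simp add: dist_commute)
      qed
      moreover have "pairing (\<lambda>v. - 1 * g v) (- k) = pairing g k" for k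
        unfolding pairing_cmult_left by (simp add: linear_neg[OF linear_pairing])
      ultimately show ?thesis using g unfolding near_norming_def by simp
    qed
    then have "tight h v u"
      using v(2) unfolding tight_def by (fastforce simp: dist_commute)
    then show ?thesis using v(1)[symmetric] by blast
  qed
qed

section \<open>Tight families of pairs\<close>

text \<open>The difference quotients along finitely many pairs can be made almost maximal with arbitrary
  signs by a single 1-Lipschitz function.\<close>

definition tight_family :: "(nat \<Rightarrow> 'a::metric_space) \<Rightarrow> (nat \<Rightarrow> 'a) \<Rightarrow> bool" where
  "tight_family u v \<longleftrightarrow> (\<forall>i. u i \<noteq> v i) \<and>
    (\<forall>A pos \<eta>. finite A \<longrightarrow> 0 < \<eta> \<longrightarrow> (\<exists>g. lip1 g \<and>
      (\<forall>i\<in>A. dist (u i) (v i) - \<eta> \<le> (if pos i then g (u i) - g (v i) else g (v i) - g (u i)))))"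

lemma tight_familyD:
  assumes "tight_family u v" "finite A" "0 < \<eta>"
  obtains g where "lip1 g"
    "\<And>i. i \<in> A \<Longrightarrow> dist (u i) (v i) - \<eta> \<le> (if pos i then g (u i) - g (v i) else g (v i) - g (u i))"
proof -
  have "\<exists>g. lip1 g \<and>
      (\<forall>i\<in>A. dist (u i) (v i) - \<eta> \<le> (if pos i then g (u i) - g (v i) else g (v i) - g (u i)))"
    using assms unfolding tight_family_def by simp
  then show ?thesis using that by blast
qed

lemma tight_family_reindex:
  assumes "tight_family u v" "inj r"
  shows "tight_family (u \<circ> r) (v \<circ> r)"
  unfolding tight_family_def
proof (intro conjI allI impI)
  show "(u \<circ> r) i \<noteq> (v \<circ> r) i" for i using assms(1) by (simp add: tight_family_def)
  fix A :: "nat set" and pos :: "nat \<Rightarrow> bool" and \<eta> :: real assume "finite A" "0 < \<eta>"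
  then obtain g where g: "lip1 g" "\<And>i. i \<in> r ` A \<Longrightarrow> dist (u i) (v i) - \<eta> \<le>
      (if (pos \<circ> inv r) i then g (u i) - g (v i) else g (v i) - g (u i))"
    using tight_familyD[OF assms(1), of "r ` A" \<eta> "pos \<circ> inv r"] by blast
  have "dist (u (r i)) (v (r i)) - \<eta> \<le>
      (if pos i then g (u (r i)) - g (v (r i)) else g (v (r i)) - g (u (r i)))" if "i \<in> A" for i
    using g(2)[of "r i"] that by (simp add: inv_f_f[OF assms(2)])
  then show "\<exists>g. lip1 g \<and> (\<forall>i\<in>A. dist ((u \<circ> r) i) ((v \<circ> r) i) - \<eta> \<le>
      (if pos i then g ((u \<circ> r) i) - g ((v \<circ> r) i) else g ((v \<circ> r) i) - g ((u \<circ> r) i)))"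
    using g(1) unfolding comp_def by blast
qed

text \<open>The signs are chosen only after the competing matching is known: colour the union of the two matchings
  properly, and let \<open>g\<close> increase towards the ends of colour \<open>True\<close> along the given pairs. Signing \<open>g\<close> by
  the colour gives \<open>R x + R y = \<plusminus>(g x - g y)\<close> on the edges of both matchings.\<close>

lemma optimal_pairs_if_disjoint_tight_family:
  assumes t: "tight_family u v" and disj: "\<And>i j. i \<noteq> j \<Longrightarrow> {u i, v i} \<inter> {u j, v j} = {}"
  shows "optimal_pairs u v"
  unfolding optimal_pairs_def min_weight_perfect_matching_def
proof (intro conjI allI impI)
  have uv: "u i \<noteq> v j" for i j
    using disj[of i j] t by (cases "i = j") (auto simp: tight_family_def)
  show inj: "inj u" "inj v" using disj by (fastforce simp: inj_def)+
  show dj: "range u \<inter> range v = {}" using uv by auto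
  fix n :: nat
  show pm: "perfect_matching (u ` {..<n} \<union> v ` {..<n}) n u v"
  proof (rule perfect_matchingI)
    show "inj_on u {..<n}" "inj_on v {..<n}" using inj by (simp_all add: inj_on_def inj_def)
    show "u ` {..<n} \<inter> v ` {..<n} = {}" using dj by blast
  qed
  fix x y assume xy: "perfect_matching (u ` {..<n} \<union> v ` {..<n}) n x y"
  obtain c where c: "\<And>i. i < n \<Longrightarrow> c (x i) \<noteq> c (y i)" "\<And>i. i < n \<Longrightarrow> c (u i) \<noteq> (c (v i) :: bool)"
    using two_colouring_of_matchings[OF xy pm] by blast
  show "matching_weight n u v \<le> matching_weight n x y"
  proof (rule field_le_epsilon)
    fix e :: real assume "0 < e"
    define \<eta> where "\<eta> = e / (real n + 1)"
    have \<eta>: "0 < \<eta>" using \<open>0 < e\<close> by (simp add: \<eta>_def)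
    obtain g where g: "lip1 g" "\<And>i. i \<in> {..<n} \<Longrightarrow> dist (u i) (v i) - \<eta> \<le>
        (if c (u i) then g (u i) - g (v i) else g (v i) - g (u i))"
      using tight_familyD[OF t, of "{..<n}" \<eta> "\<lambda>i. c (u i)"] \<eta> by blast
    define R where "R p = (if c p then g p else - g p)" for p
    have "matching_weight n u v \<le> matching_weight n x y + n * \<eta>"
    proof (rule matching_weight_le_if_potential[OF pm xy, where R = R])
      fix i assume i: "i < n"
      then have "dist (u i) (v i) - \<eta> \<le> (if c (u i) then g (u i) - g (v i) else g (v i) - g (u i))"
        using g(2) by simp
      then show "dist (u i) (v i) \<le> R (u i) + R (v i) + \<eta>"
        using c(2)[OF i] by (auto simp: R_def split: if_splits)
      have "g (x i) - g (y i) \<le> dist (x i) (y i)" "g (y i) - g (x i) \<le> dist (y i) (x i)"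
        using g(1) by blast+
      then show "R (x i) + R (y i) \<le> dist (x i) (y i)"
        using c(1)[OF i] by (auto simp: R_def dist_commute)
    qed
    also have "n * \<eta> \<le> e" using \<open>0 < e\<close> by (simp add: \<eta>_def field_simps)
    finally show "matching_weight n u v \<le> matching_weight n x y + e" by simp
  qed
qed

text \<open>With opposite signs on two edges at \<open>c\<close>, the function \<open>g\<close> shows that the way through \<open>c\<close> is a
  shortest one between the outer ends. So \<open>R = dist _ c\<close> has no defect at all.\<close>

lemma optimal_pairs_if_tight_star:
  fixes z :: "nat \<Rightarrow> 'a::metric_space"
  assumes ne: "\<And>i. z i \<noteq> c"
    and t: "\<And>i j \<eta>. i \<noteq> j \<Longrightarrow> 0 < \<eta> \<Longrightarrow> \<exists>g. lip1 g \<and> dist (z i) c - \<eta> \<le> g (z i) - g c \<and>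
      dist (z j) c - \<eta> \<le> g c - g (z j)"
  shows "\<exists>x y :: nat \<Rightarrow> 'a. optimal_pairs x y"
proof (rule optimal_pairs_if_asymptotic_potential)
  have star: "dist (z i) (z j) = dist (z i) c + dist (z j) c" if ij: "i \<noteq> j" for i j
  proof (rule antisym)
    show "dist (z i) c + dist (z j) c \<le> dist (z i) (z j)"
    proof (rule field_le_epsilon)
      fix e :: real assume "0 < e"
      then have "0 < e / 2" by simp
      from t[OF ij this] obtain g where g: "lip1 g" "dist (z i) c - e / 2 \<le> g (z i) - g c"
        "dist (z j) c - e / 2 \<le> g c - g (z j)" by blast
      have "g (z i) - g (z j) \<le> dist (z i) (z j)" using g(1) by blast
      then show "dist (z i) c + dist (z j) c \<le> dist (z i) (z j) + e" using g(2,3) by simp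
    qed
  qed (rule dist_triangle2)
  show "inj z"
  proof (rule injI, rule ccontr)
    fix i j assume "z i = z j" "i \<noteq> j"
    then show False using star[of i j] ne[of i] by auto
  qed
  show "dist (z m) (z n) \<le> dist (z m) c + dist (z n) c" for m n by (rule dist_triangle2)
  show "(\<lambda>n. dist (z m) c + dist (z n) c - dist (z m) (z n)) \<longlonglongrightarrow> 0" for m
  proof (rule tendsto_eventually)
    show "\<forall>\<^sub>F n in sequentially. dist (z m) c + dist (z n) c - dist (z m) (z n) = 0"
      using eventually_gt_at_top[of m] by eventually_elim (use star[of m] in auto)
  qed
qed

text \<open>A family of infinitely many edges has an infinite star or an infinite disjoint subfamily.\<close>

lemma optimal_pairs_if_tight_family:
  fixes u v :: "nat \<Rightarrow> 'a::metric_space"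
  assumes t: "tight_family u v"
  shows "\<exists>x y :: nat \<Rightarrow> 'a. optimal_pairs x y"
proof (cases "\<exists>c. infinite {i. c \<in> {u i, v i}}")
  case True
  then obtain c where inf: "infinite {i. c \<in> {u i, v i}}" by blast
  define r where "r = enumerate {i. c \<in> {u i, v i}}"
  have r: "inj r" "c \<in> {u (r i), v (r i)}" for i
    using strict_mono_enumerate[OF inf] enumerate_in_set[OF inf, of i]
    by (auto simp: r_def strict_mono_imp_inj_on)
  define z where "z i = (if u (r i) = c then v (r i) else u (r i))" for i
  show ?thesis
  proof (rule optimal_pairs_if_tight_star[of z c])
    show "z i \<noteq> c" for i using t by (auto simp: z_def tight_family_def dest: sym)
    fix i j :: nat and \<eta> :: real assume "i \<noteq> j" "0 < \<eta>"
    have ij: "r i \<noteq> r j" using r(1) \<open>i \<noteq> j\<close> by (auto dest: injD)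
    define pos where "pos k = (if k = r i then u k \<noteq> c else u k = c)" for k
    obtain g where g: "lip1 g" "\<And>k. k \<in> {r i, r j} \<Longrightarrow> dist (u k) (v k) - \<eta> \<le>
        (if pos k then g (u k) - g (v k) else g (v k) - g (u k))"
      using tight_familyD[OF t, of "{r i, r j}" \<eta> pos] \<open>0 < \<eta>\<close> by blast
    have "dist (z i) c - \<eta> \<le> g (z i) - g c"
      using g(2)[of "r i"] r(2)[of i] by (auto simp: pos_def z_def dist_commute split: if_splits)
    moreover have "dist (z j) c - \<eta> \<le> g c - g (z j)"
      using g(2)[of "r j"] r(2)[of j] ij by (auto simp: pos_def z_def dist_commute split: if_splits)
    ultimately show "\<exists>g. lip1 g \<and> dist (z i) c - \<eta> \<le> g (z i) - g c \<and>
      dist (z j) c - \<eta> \<le> g c - g (z j)" using g(1) by blast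
  qed
next
  case False
  define E where "E i = {u i, v i}" for i
  have bound: "\<exists>N>i. \<forall>l\<ge>N. E l \<inter> E i = {}" for i
  proof -
    have "finite ({l. u i \<in> E l} \<union> {l. v i \<in> E l} \<union> {i})" using False by (simp add: E_def)
    then obtain N where N: "\<forall>l\<in>{l. u i \<in> E l} \<union> {l. v i \<in> E l} \<union> {i}. l < N"
      by (meson finite_nat_iff_bounded lessThan_iff subsetD)
    have "E l \<inter> E i = {}" if "N \<le> l" for l
    proof -
      have "u i \<notin> E l" "v i \<notin> E l" using N that by (auto simp: not_less[symmetric])
      then show ?thesis by (auto simp: E_def)
    qed
    then show ?thesis using N by blast
  qed
  have "\<exists>r. \<forall>k::nat. True \<and> (r k < r (Suc k) \<and> (\<forall>l\<ge>r (Suc k). E l \<inter> E (r k) = {}))"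
    by (rule dependent_nat_choice) (use bound in auto)
  then obtain r where r: "\<And>k::nat. r k < r (Suc k)" "\<And>k l. r (Suc k) \<le> l \<Longrightarrow> E l \<inter> E (r k) = {}"
    by blast
  have sm: "strict_mono r" using r(1) by (simp add: strict_mono_Suc_iff)
  have "E (r k) \<inter> E (r l) = {}" if "k < l" for k l
  proof -
    have "r (Suc k) \<le> r l" using that sm by (simp add: strict_mono_less_eq)
    then show ?thesis using r(2)[of k "r l"] by blast
  qed
  then have "E (r k) \<inter> E (r l) = {}" if "k \<noteq> l" for k l
    using that by (metis inf_commute nat_neq_iff)
  then have "optimal_pairs (u \<circ> r) (v \<circ> r)"
    using tight_family_reindex[OF t strict_mono_imp_inj_on[OF sm]]
    by (intro optimal_pairs_if_disjoint_tight_family) (simp_all add: E_def)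
  then show ?thesis by blast
qed

section \<open>Isometric copies of the sequence space yield optimal pairs\<close>

definition unit_ell1 :: "nat \<Rightarrow> ell1" where
  "unit_ell1 i = Abs_ell1 (\<lambda>j. if j = i then 1 else 0)"

lemma ell1_nth_unit: "ell1_nth (unit_ell1 i) j = (if j = i then 1 else 0)"
proof -
  have "summable (\<lambda>j. \<bar>if j = i then 1 else 0 :: real\<bar>)"
    by (rule summable_finite[of "{i}"]) auto
  then show ?thesis unfolding unit_ell1_def by (subst Abs_ell1_inverse) auto
qed

lemma norm_unit_ell1: "norm (unit_ell1 i) = 1"
proof -
  have "norm (unit_ell1 i) = (\<Sum>j. \<bar>if j = i then 1 else 0 :: real\<bar>)"
    by (simp add: norm_ell1.rep_eq ell1_nth_unit)
  also have "\<dots> = (\<Sum>j\<in>{i}. \<bar>if j = i then 1 else 0\<bar>)" by (rule suminf_finite) auto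
  finally show ?thesis by simp
qed

lemma norm_sum_unit_ell1: "norm (\<Sum>i<n. s i *\<^sub>R unit_ell1 i) = (\<Sum>i<n. \<bar>s i\<bar>)"
proof -
  have nth: "ell1_nth (\<Sum>i<n. s i *\<^sub>R unit_ell1 i) j = (if j < n then s j else 0)" for j
    by (induction n) (auto simp: zero_ell1.rep_eq plus_ell1.rep_eq scaleR_ell1.rep_eq ell1_nth_unit less_Suc_eq)
  have "(\<Sum>j. \<bar>if j < n then s j else 0\<bar>) = (\<Sum>j\<in>{..<n}. \<bar>if j < n then s j else 0\<bar>)"
    by (rule suminf_finite) auto
  then show ?thesis by (simp add: norm_ell1.rep_eq nth)
qed

lemma Cauchy_if_to_completion_tendsto:
  assumes "(\<lambda>n. to_completion (h n)) \<longlonglongrightarrow> z"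
  shows "Cauchy h"
proof (rule CauchyI)
  fix e :: real assume "0 < e"
  then obtain M where M: "\<forall>m\<ge>M. \<forall>n\<ge>M. norm (to_completion (h m) - to_completion (h n)) < e"
    using CauchyD[OF LIMSEQ_imp_Cauchy[OF assms]] by blast
  have "norm (to_completion (h m) - to_completion (h n)) = norm (h m - h n)" for m n
    by (simp add: linear_diff[OF linear_to_completion, symmetric] norm_to_completion)
  then show "\<exists>M. \<forall>m\<ge>M. \<forall>n\<ge>M. norm (h m - h n) < e" using M by metis
qed

lemma approximation_in_completion:
  obtains h where "(\<lambda>n. to_completion (h n :: 'b::real_normed_vector)) \<longlonglongrightarrow> z"
proof -
  have "z \<in> closure (range to_completion)" by (simp add: closure_range_to_completion)
  then obtain k where k: "\<And>n. k n \<in> range to_completion" "k \<longlonglongrightarrow> z"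
    unfolding closure_sequential by blast
  then have "\<forall>n. \<exists>x. k n = to_completion x" by auto
  then obtain h where "\<And>n. k n = to_completion (h n)" by metis
  then have "k = (\<lambda>n. to_completion (h n))" by auto
  then show ?thesis using k(2) that by blast
qed

text \<open>Replace the images \<open>E i\<close> of the unit vectors by transportation problems \<open>h i m\<close> converging to them.
  As the norm of \<open>\<Sum>i<n. s i * E i\<close> equals the sum of the norms, the quantity \<open>excess m\<close>, by which the triangle
  inequality for the \<open>h i m\<close> fails to be sharp, tends to 0. It bounds by how much a function norming
  the sum can fail to norm one summand, up to the sign \<open>s i\<close>.\<close>

lemma tight_family_if_isometry:
  fixes T :: "ell1 \<Rightarrow> 'a::metric_space TC"
  assumes disc: "0 < \<delta>" "\<And>u v :: 'a. u \<noteq> v \<Longrightarrow> \<delta> \<le> dist u v"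
    and T: "linear T" "\<And>s. norm (T s) = norm s"
  shows "\<exists>u v :: nat \<Rightarrow> 'a. tight_family u v"
proof -
  define E where "E i = T (unit_ell1 i)" for i
  have normE: "norm (\<Sum>i<n. s i *\<^sub>R E i) = (\<Sum>i<n. \<bar>s i\<bar>)" for s :: "nat \<Rightarrow> real" and n
  proof -
    have "(\<Sum>i<n. s i *\<^sub>R E i) = T (\<Sum>i<n. s i *\<^sub>R unit_ell1 i)"
      by (simp add: E_def linear_sum[OF T(1)] linear_scale[OF T(1)])
    then show ?thesis by (simp add: T(2) norm_sum_unit_ell1)
  qed
  have norm1: "norm (E i) = 1" for i by (simp add: E_def T(2) norm_unit_ell1)
  have "\<exists>k. (\<lambda>n. to_completion (k n)) \<longlonglongrightarrow> E i" for i
    using approximation_in_completion[of "E i"] by blast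
  then obtain h where h: "\<And>i. (\<lambda>n. to_completion (h i n)) \<longlonglongrightarrow> E i" by metis
  have Ch: "Cauchy (h i)" for i by (rule Cauchy_if_to_completion_tendsto[OF h])
  have norm_h: "(\<lambda>n. norm (h i n)) \<longlonglongrightarrow> 1" for i
    using tendsto_norm[OF h[of i]] by (simp add: norm_to_completion norm1)
  have "\<exists>p q. p \<noteq> q \<and> tight (h i) p q" for i
    by (rule tight_pair[OF disc Ch norm_h]) auto
  then obtain u v where uv: "\<And>i. u i \<noteq> v i" "\<And>i. tight (h i) (u i) (v i)" by metis
  have "tight_family u v"
    unfolding tight_family_def
  proof (intro conjI allI impI uv(1))
    fix A :: "nat set" and pos :: "nat \<Rightarrow> bool" and \<eta> :: real assume "finite A" "0 < \<eta>"
    obtain n where n: "A \<subseteq> {..<n}" using \<open>finite A\<close> finite_nat_iff_bounded by blast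
    define s where "s i = (if pos i then 1 else - 1 :: real)" for i
    have s: "\<bar>s i\<bar> = 1" for i by (auto simp: s_def)
    have "\<exists>\<theta>>0. \<forall>g\<in>near_norming \<theta> (h i). dist (u i) (v i) - (g (u i) - g (v i)) \<le> \<eta>" for i
      using uv(2)[of i] \<open>0 < \<eta>\<close> by (simp add: tight_def)
    then obtain \<theta> where \<theta>: "\<And>i. 0 < \<theta> i"
      "\<And>i g. g \<in> near_norming (\<theta> i) (h i) \<Longrightarrow> dist (u i) (v i) - (g (u i) - g (v i)) \<le> \<eta>"
      by metis
    define F where "F m = (\<Sum>i<n. s i *\<^sub>R h i m)" for m
    define excess where "excess m = (\<Sum>i<n. norm (h i m)) - norm (F m)" for m
    have "(\<lambda>m. to_completion (F m)) \<longlonglongrightarrow> (\<Sum>i<n. s i *\<^sub>R E i)"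
      unfolding F_def
      by (simp add: linear_sum[OF linear_to_completion] linear_scale[OF linear_to_completion])
        (intro tendsto_intros h)
    from tendsto_norm[OF this] have "(\<lambda>m. norm (F m)) \<longlonglongrightarrow> n"
      by (simp add: norm_to_completion normE s)
    moreover have "(\<lambda>m. \<Sum>i<n. norm (h i m)) \<longlonglongrightarrow> (\<Sum>i<n. 1 :: real)" by (intro tendsto_intros norm_h)
    ultimately have "excess \<longlonglongrightarrow> (\<Sum>i<n. 1 :: real) - real n"
      unfolding excess_def by (intro tendsto_diff)
    then have excess: "excess \<longlonglongrightarrow> 0" by simp
    have "\<forall>\<^sub>F m in sequentially. \<forall>i\<in>{..<n}. excess m < \<theta> i / 3"
      using \<theta>(1) by (intro eventually_ball_finite ballI order_tendstoD(2)[OF excess]) auto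
    moreover have "\<forall>\<^sub>F m in sequentially. \<forall>i\<in>{..<n}. \<forall>k\<ge>m. norm (h i k - h i m) < \<theta> i / 3"
    proof (intro eventually_ball_finite ballI)
      fix i
      have "0 < \<theta> i / 3" using \<theta>(1) by simp
      then obtain M where "\<forall>k\<ge>M. \<forall>m\<ge>M. norm (h i k - h i m) < \<theta> i / 3" using CauchyD[OF Ch] by blast
      then show "\<forall>\<^sub>F m in sequentially. \<forall>k\<ge>m. norm (h i k - h i m) < \<theta> i / 3"
        by (auto simp: eventually_sequentially intro!: exI[of _ M])
    qed simp
    ultimately have "\<exists>m. (\<forall>i\<in>{..<n}. excess m < \<theta> i / 3) \<and>
        (\<forall>i\<in>{..<n}. \<forall>k\<ge>m. norm (h i k - h i m) < \<theta> i / 3)"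
      by (rule eventually_happens'[OF sequentially_bot eventually_conj])
    then obtain m where m: "\<And>i. i < n \<Longrightarrow> excess m < \<theta> i / 3"
      "\<And>i k. i < n \<Longrightarrow> m \<le> k \<Longrightarrow> norm (h i k - h i m) < \<theta> i / 3"
      by auto
    obtain g D where g: "lip1 g" "pairing g (F m) = norm (F m)" "\<And>v. \<bar>g v\<bar> \<le> D"
      using norming_function[of "F m"] by blast
    have near: "(\<lambda>p. s i * g p) \<in> near_norming (\<theta> i) (h i)" if i: "i < n" for i
    proof -
      have lip: "s i * g p - s i * g q \<le> dist p q" for p q
      proof -
        have "g p - g q \<le> dist p q" "g q - g p \<le> dist q p" using g(1) by blast+
        then show ?thesis by (auto simp: s_def dist_commute)
      qed
      have le: "s j * pairing g (h j m) \<le> norm (h j m)" for j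
        using abs_pairing_le_norm[OF g(1), of "h j m"] by (auto simp: s_def abs_le_iff)
      have "norm (F m) = (\<Sum>j<n. s j * pairing g (h j m))"
        using g(2) unfolding F_def
        by (simp add: linear_sum[OF linear_pairing] linear_scale[OF linear_pairing])
      then have "excess m = (\<Sum>j<n. norm (h j m) - s j * pairing g (h j m))"
        by (simp add: excess_def sum_subtractf)
      moreover have "norm (h i m) - s i * pairing g (h i m) \<le> (\<Sum>j<n. norm (h j m) - s j * pairing g (h j m))"
        using le i by (intro member_le_sum) auto
      ultimately have base: "norm (h i m) - \<theta> i / 3 \<le> s i * pairing g (h i m)" using m(1)[OF i] by linarith
      have "norm (h i k) - \<theta> i \<le> pairing (\<lambda>p. s i * g p) (h i k)" if "k \<ge> m" for k
      proof -
        have "s i * pairing g (h i m) - s i * pairing g (h i k) \<le> norm (h i k - h i m)"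
          using abs_pairing_le_norm[OF g(1), of "h i k - h i m"]
          by (auto simp: s_def linear_diff[OF linear_pairing] abs_le_iff)
        moreover have "norm (h i k) - norm (h i m) \<le> norm (h i k - h i m)" by (rule norm_triangle_ineq2)
        ultimately show ?thesis unfolding pairing_cmult_left using base m(2)[OF i that] by linarith
      qed
      then show ?thesis using lip unfolding near_norming_def eventually_sequentially by blast
    qed
    have "dist (u i) (v i) - \<eta> \<le> (if pos i then g (u i) - g (v i) else g (v i) - g (u i))" if "i \<in> A" for i
    proof -
      have "i < n" using that n by auto
      then have "dist (u i) (v i) - (s i * g (u i) - s i * g (v i)) \<le> \<eta>" using \<theta>(2)[OF near] by simp
      then show ?thesis by (simp add: s_def split: if_splits)
    qed
    then show "\<exists>g. lip1 g \<and> (\<forall>i\<in>A. dist (u i) (v i) - \<eta> \<le>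
        (if pos i then g (u i) - g (v i) else g (v i) - g (u i)))" using g(1) by blast
  qed
  then show ?thesis by blast
qed

lemma optimal_pairs_if_isometry:
  fixes T :: "ell1 \<Rightarrow> 'a::metric_space TC"
  assumes "linear T" "\<And>s. norm (T s) = norm s"
  shows "\<exists>x y :: nat \<Rightarrow> 'a. optimal_pairs x y"
proof (cases "\<exists>\<delta>>0. \<forall>u v :: 'a. u \<noteq> v \<longrightarrow> \<delta> \<le> dist u v")
  case True
  then show ?thesis
    using tight_family_if_isometry[OF _ _ assms] optimal_pairs_if_tight_family by metis
next
  case False
  then show ?thesis
    by (intro optimal_pairs_if_not_uniformly_discrete) (meson not_le)
qed

theorem theorem2p1:
  assumes "infinite (UNIV :: 'a::metric_space set)"
  shows "(\<exists>T :: ell1 \<Rightarrow> 'a TC. linear T \<and> (\<forall>s. norm (T s) = norm s)) \<longleftrightarrow>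
    (\<exists>x y :: nat \<Rightarrow> 'a.
       inj x \<and> inj y \<and> range x \<inter> range y = {} \<and>
       (\<forall>n\<ge>1. min_weight_perfect_matching (x ` {..<n} \<union> y ` {..<n}) n x y))"
  unfolding optimal_pairs_def[symmetric]
  using optimal_pairs_if_isometry isometry_if_optimal_pairs by blast

end
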